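(* Let $\varepsilon_0\in(0,\infty)$, and let the domain $\Omega$, the kernels $\gamma=\gamma_\varepsilon$ and the decompositions $\Omega_I=\Omega_N\cup\Omega_D$, $\Gamma=\Gamma_N\cup\Gamma_D$ (for $\varepsilon\in(0,\varepsilon_0]$) be as in the context. Then there is a constant $\widehat C>0$, independent of $\varepsilon$ and of $u_l$, such that the following holds for every $\varepsilon\in(0,\varepsilon_0]$ and all data $s,g_l,v_n$ as in the context. Suppose $u_l\in C^4(\widehat\Omega)$ solves the local problem $$-\Delta u_l=s \ \text{ in }\widehat\Omega,\qquad -\nabla u_l\cdot\mathbf n=g_l\ \text{ on }\Gamma_N,\qquad u_l=v_n\ \text{ on }\Gamma_D.$$ Let $\widetilde u_n\in V(\widehat\Omega)$ be the (weak) solution of the nonlocal problem $$-\mathcal L\widetilde u_n=s\ \text{ in }\Omega,\qquad -\mathcal N(\mathcal G\widetilde u_n)=\widetilde g_n\ \text{ in }\Omega_N,\qquad \widetilde u_n=v_n\ \text{ in }\Omega_D,$$ with Neumann data $\widetilde g_n:=-\mathcal N(\mathcal G u_l)$ on $\Omega_N$. Then the $L^2$ norm of the difference between the local and nonlocal solutions converges at least quadratically in $\varepsilon$; precisely, $$\|\widetilde u_n-u_l\|_{L^2(\widehat\Omega)}\le C_{pn}\,|||\widetilde u_n-u_l|||\le \widehat C\,\varepsilon^2\,\|D^{(4)}u_l\|_{\infty,\widehat\Omega},$$ where $C_{pn}$ is the nonlocal Poincaré constant.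
   Context: Setting. $\Omega\subset\mathbb R^d$, $d\in\{1,2,3\}$, is a fixed bounded open set with Lipschitz boundary. For each horizon $\varepsilon\in(0,\varepsilon_0]$, $\Omega_I=\{y\in\mathbb R^d\setminus\Omega:\ \|y-x\|<\varepsilon \text{ for some }x\in\Omega\}$, $\widehat\Omega=\Omega\cup\Omega_I$ (this depends on $\varepsilon$), and $\Gamma=\partial\widehat\Omega$ with outer unit normal $\mathbf n$. $\Omega_I$ is the disjoint union of $\Omega_N$ and $\Omega_D$, and $\Gamma$ is the disjoint union of $\Gamma_N$ and $\Gamma_D$ ($\Gamma_N$, $\Gamma_D$ being the parts of the outer boundary adjacent to $\Omega_N$, $\Omega_D$ respectively). Kernel. $\gamma=\gamma_\varepsilon:\mathbb R^d\times\mathbb R^d\to[0,\infty)$ is symmetric, of the form $\gamma(x,y)=\alpha(x,y)\cdot\alpha(x,y)$ with $\alpha$ an antisymmetric $\mathbb R^d$-valued function, and for $x\in\Omega$ satisfies $\gamma(x,y)>0$ if $\|x-y\|<\varepsilon$ and $\gamma(x,y)=0$ for $y\in\widehat\Omega$ with $\|x-y\|\ge\varepsilon$. Operators. The nonlocal gradient is $\mathcal G w(x,y)=(w(y)-w(x))\,\alpha(x,y)$, so $|\mathcal G w(x,y)|^2=(w(y)-w(x))^2\gamma(x,y)$. The nonlocal diffusion operator is, for $x\in\Omega$, $\mathcal L w(x)=2\int_{\widehat\Omega}(w(y)-w(x))\gamma(x,y)\,dy$. The nonlocal Neumann (interaction) operator is given, for $x\in\Omega_N$, by $-\mathcal N(\mathcal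 G w)(x)=2\int_{\widehat\Omega}(w(x)-w(y))\gamma(x,y)\,dy$. (Integrals are understood in the principal value sense if $\gamma$ is not integrable.) Normalization of the kernel. $\gamma$ is scaled so that $\mathcal L w\to\Delta w$ as $\varepsilon\to0$, and $\mathcal L$ coincides with $\Delta$ on polynomials of degree at most three: $\mathcal L p(x)=\Delta p(x)$ for all $x\in\Omega$. Spaces. $|||v|||^2=\frac12\int_{\widehat\Omega}\int_{\widehat\Omega}|\mathcal G v(x,y)|^2\,dy\,dx$, $V(\widehat\Omega)=\{v\in L^2(\widehat\Omega): |||v|||<\infty\}$, $V_c(\widehat\Omega)=\{v\in V(\widehat\Omega): v=0 \text{ on }\Omega_D\}$, with dual $V_c'(\widehat\Omega)$ with respect to the $L^2$ pairing. $C^4(\widehat\Omega)$ denotes functions that are $C^4$ up to the boundary; these belong to $V(\widehat\Omega)$. $D^{(4)}u$ is the collection of fourth-order partial derivatives of $u$ and $\|\cdot\|_{\infty,\widehat\Omega}$ is the sup norm on $\widehat\Omega$. Data. $s\in V_c'(\widehat\Omega)$ is a forcing term over $\widehat\Omega$, $g_l\in L^2(\Gamma_N)$ is the local Neumann datum, and $v_n$ is the nonlocal Dirichlet datum on $\Omega_D$, the restriction to $\Omega_D$ of a function in $V(\widehat\Omega)$, with a well-defined trace $v_n|_{\Gamma_D}\in H^{1/2}(\Gamma_D)$. Poincaré inequality (standing assumption). There is a constant $C_{pn}$, independent of $\varepsilon\in(0,\varepsilon_0]$, with $\|v\|_{L^2(\widehat\Omega)}\le C_{pn}|||v|||$ for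 all $v\in V_c(\widehat\Omega)$. Green identity (part of the nonlocal calculus framework). For $w\in C^4(\widehat\Omega)$ and $z\in V_c(\widehat\Omega)$, $$\int_{\widehat\Omega}\int_{\widehat\Omega}(w(x)-w(y))(z(x)-z(y))\gamma(x,y)\,dy\,dx=-\int_\Omega \mathcal L w\,z\,dx-\int_{\Omega_N}\mathcal N(\mathcal G w)\,z\,dx,$$ the last term being understood as a duality pairing (bounded in $z\in V_c(\widehat\Omega)$). Weak solution. $\widetilde u_n\in V(\widehat\Omega)$ is the weak solution of the nonlocal problem if $\widetilde u_n=v_n$ on $\Omega_D$ and, for all $z\in V_c(\widehat\Omega)$, $$\int_{\widehat\Omega}\int_{\widehat\Omega}(\widetilde u_n(x)-\widetilde u_n(y))(z(x)-z(y))\gamma(x,y)\,dy\,dx=\int_{\Omega_N}\widetilde g_n\,z\,dx+\int_\Omega s\,z\,dx.$$ It exists and is unique.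
   Formalization: The formal theorem also assumes u_l = v_n almost everywhere on all of Ω_D, not only on Γ_D; without this the claim is false, e.g. d = 1, Ω = (0,1), Ω_D = [1,1+ε), constant kernel, u_l = s = g_l = 0, v_n(x) = 1+ε−x. *)

theory Defs
  imports "HOL-Analysis.Analysis"
begin

section \<open>Domains\<close>

(* Near each boundary point the set is the strict epigraph, in direction e, of a Lipschitz function
   of the component orthogonal to e.  Taking phi on the whole hyperplane is no restriction, since
   Lipschitz functions extend. *)
definition lipschitz_boundary :: "(real ^ 'd) set \<Rightarrow> bool" where
  "lipschitz_boundary S \<longleftrightarrow>
    (\<forall>p \<in> frontier S. \<exists>e \<phi> L r. norm e = 1 \<and> r > 0 \<and> lipschitz_on L {v. v \<bullet> e = 0} \<phi> \<and>
       (\<forall>x \<in> ball p r. x \<in> S \<longleftrightarrow> \<phi> (x - (x \<bullet> e) *\<^sub>R e) < x \<bullet> e))"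

definition interaction_domain :: "(real ^ 'd) set \<Rightarrow> real \<Rightarrow> (real ^ 'd) set" where
  "interaction_domain \<Omega> \<epsilon> = {y. y \<notin> \<Omega> \<and> (\<exists>x \<in> \<Omega>. norm (y - x) < \<epsilon>)}"

definition extended_domain :: "(real ^ 'd) set \<Rightarrow> real \<Rightarrow> (real ^ 'd) set" where
  "extended_domain \<Omega> \<epsilon> = \<Omega> \<union> interaction_domain \<Omega> \<epsilon>"

section \<open>Surface measure, outer normal, traces\<close>

definition hausdorff_pre :: "real \<Rightarrow> (real ^ 'd) set \<Rightarrow> ennreal" where
  "hausdorff_pre \<delta> A =
    Inf {(\<Sum>n. if E n = {} then 0
             else ennreal (unit_ball_vol (real (CARD('d) - 1)) * (diameter (E n) / 2) ^ (CARD('d) - 1)))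
         | E :: nat \<Rightarrow> (real ^ 'd) set.
           A \<subseteq> (\<Union>n. E n) \<and> (\<forall>n. bounded (E n) \<and> diameter (E n) \<le> \<delta>)}"

definition hausdorff_outer :: "(real ^ 'd) set \<Rightarrow> ennreal" where
  "hausdorff_outer A = (SUP \<delta> \<in> {0<..}. hausdorff_pre \<delta> A)"

(* The (d-1)-dimensional Hausdorff measure on its Caratheodory sigma-algebra (which contains the
   Borel sets and all null sets); for d = 1 it is counting measure. *)
definition surface_measure :: "(real ^ 'd) measure" where
  "surface_measure = measure_of UNIV (lambda_system UNIV UNIV hausdorff_outer) hausdorff_outer"

(* Unit vector such that, blown up at p, the set S becomes the half space opposite to it. *)
definition outer_unit_normal :: "(real ^ 'd) set \<Rightarrow> real ^ 'd \<Rightarrow> real ^ 'd \<Rightarrow> bool" where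
  "outer_unit_normal S p \<nu> \<longleftrightarrow> norm \<nu> = 1 \<and>
    (\<forall>\<eta>>0. \<exists>r>0. \<forall>y \<in> ball p r.
       ((y - p) \<bullet> \<nu> < - \<eta> * norm (y - p) \<longrightarrow> y \<in> S) \<and>
       ((y - p) \<bullet> \<nu> > \<eta> * norm (y - p) \<longrightarrow> y \<notin> S))"

(* t is the trace at p of the function v given on A: the limit, in mean, of v over the part
   of A near p. *)
definition has_trace_at :: "(real ^ 'd) set \<Rightarrow> (real ^ 'd \<Rightarrow> real) \<Rightarrow> real ^ 'd \<Rightarrow> real \<Rightarrow> bool" where
  "has_trace_at A v p t \<longleftrightarrow> (\<forall>r>0. 0 < emeasure lebesgue (A \<inter> ball p r)) \<and>
    ((\<lambda>r. (\<integral>\<^sup>+ y \<in> A \<inter> ball p r. ennreal \<bar>v y - t\<bar> \<partial>lebesgue) / emeasure lebesgue (A \<inter> ball p r))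
       \<longlongrightarrow> 0) (at_right 0)"

definition L2_on :: "(real ^ 'd) measure \<Rightarrow> (real ^ 'd) set \<Rightarrow> (real ^ 'd \<Rightarrow> real) \<Rightarrow> bool" where
  "L2_on M A f \<longleftrightarrow> set_borel_measurable M A f \<and> (\<integral>\<^sup>+ x \<in> A. ennreal ((f x)\<^sup>2) \<partial>M) < \<infinity>"

definition L2_norm :: "(real ^ 'd) set \<Rightarrow> (real ^ 'd \<Rightarrow> real) \<Rightarrow> real" where
  "L2_norm S v = sqrt (LINT x:S|lebesgue. (v x)\<^sup>2)"

(* Sobolev-Slobodeckij space on a (d-1)-dimensional surface: the exponent is (d-1) + 2 * (1/2). *)
definition H_half :: "(real ^ 'd) set \<Rightarrow> (real ^ 'd \<Rightarrow> real) \<Rightarrow> bool" where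
  "H_half G f \<longleftrightarrow> L2_on surface_measure G f \<and>
    (\<integral>\<^sup>+ x \<in> G. (\<integral>\<^sup>+ y \<in> G. ennreal ((f x - f y)\<^sup>2 / norm (x - y) ^ CARD('d))
        \<partial>surface_measure) \<partial>surface_measure) < \<infinity>"

section \<open>Classical derivatives\<close>

definition partial_deriv :: "'d \<Rightarrow> (real ^ 'd \<Rightarrow> real) \<Rightarrow> real ^ 'd \<Rightarrow> real" where
  "partial_deriv i f x = deriv (\<lambda>t. f (x + t *\<^sub>R axis i 1)) 0"

fun partial_derivs :: "'d list \<Rightarrow> (real ^ 'd \<Rightarrow> real) \<Rightarrow> real ^ 'd \<Rightarrow> real" where
  "partial_derivs [] f = f"
| "partial_derivs (i # js) f = partial_deriv i (partial_derivs js f)"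

definition laplacian :: "(real ^ 'd \<Rightarrow> real) \<Rightarrow> real ^ 'd \<Rightarrow> real" where
  "laplacian f x = (\<Sum>i\<in>UNIV. partial_derivs [i, i] f x)"

(* C^k up to the boundary of the open set S: all partial derivatives of order at most k exist in S
   and have continuous extensions to the closure of S; f itself is given on the closure. *)
definition C_up_to_boundary :: "nat \<Rightarrow> (real ^ 'd) set \<Rightarrow> (real ^ 'd \<Rightarrow> real) \<Rightarrow> bool" where
  "C_up_to_boundary k S f \<longleftrightarrow> continuous_on (closure S) f \<and>
    (\<forall>js. length js < k \<longrightarrow> (\<forall>x \<in> S. partial_derivs js f differentiable (at x))) \<and>
    (\<forall>js. length js \<le> k \<longrightarrow>
       (\<exists>g. continuous_on (closure S) g \<and> (\<forall>x \<in> S. g x = partial_derivs js f x)))"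

(* The gradient at a boundary point p is the limit of the gradient from inside S. *)
definition normal_deriv :: "(real ^ 'd) set \<Rightarrow> (real ^ 'd \<Rightarrow> real) \<Rightarrow> real ^ 'd \<Rightarrow> real ^ 'd \<Rightarrow> real" where
  "normal_deriv S f p \<nu> = (\<Sum>i\<in>UNIV. Lim (at p within S) (partial_deriv i f) * \<nu> $ i)"

(* Inserting 0 only matters for empty S. *)
definition D4_sup_norm :: "(real ^ 'd) set \<Rightarrow> (real ^ 'd \<Rightarrow> real) \<Rightarrow> real" where
  "D4_sup_norm S f = Sup (insert 0 {\<bar>partial_derivs js f x\<bar> | js x. length js = 4 \<and> x \<in> S})"

definition polynomial_deg_le :: "nat \<Rightarrow> (real ^ 'd \<Rightarrow> real) \<Rightarrow> bool" where
  "polynomial_deg_le m p \<longleftrightarrow>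
    (\<exists>c. p = (\<lambda>x. \<Sum>k | (\<Sum>i\<in>UNIV. k i) \<le> m. c k * (\<Prod>i\<in>UNIV. (x $ i) ^ k i)))"

section \<open>Principal values and nonlocal operators\<close>

definition has_pv_integral ::
  "(real ^ 'd \<Rightarrow> real) \<Rightarrow> real \<Rightarrow> (real ^ 'd) set \<Rightarrow> real ^ 'd \<Rightarrow> bool" where
  "has_pv_integral f I S x \<longleftrightarrow> (\<forall>r>0. set_integrable lebesgue (S - ball x r) f) \<and>
    ((\<lambda>r. LINT y:S - ball x r|lebesgue. f y) \<longlongrightarrow> I) (at_right 0)"

definition pv_integrable :: "(real ^ 'd \<Rightarrow> real) \<Rightarrow> (real ^ 'd) set \<Rightarrow> real ^ 'd \<Rightarrow> bool" where
  "pv_integrable f S x \<longleftrightarrow> (\<exists>I. has_pv_integral f I S x)"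

definition pv_integral :: "(real ^ 'd \<Rightarrow> real) \<Rightarrow> (real ^ 'd) set \<Rightarrow> real ^ 'd \<Rightarrow> real" where
  "pv_integral f S x = (THE I. has_pv_integral f I S x)"

(* The kernel gamma = alpha . alpha. *)
definition ker :: "(real ^ 'd \<Rightarrow> real ^ 'd \<Rightarrow> real ^ 'd) \<Rightarrow> real ^ 'd \<Rightarrow> real ^ 'd \<Rightarrow> real" where
  "ker \<alpha> x y = \<alpha> x y \<bullet> \<alpha> x y"

definition nonlocal_grad ::
  "(real ^ 'd \<Rightarrow> real ^ 'd \<Rightarrow> real ^ 'd) \<Rightarrow> (real ^ 'd \<Rightarrow> real) \<Rightarrow> real ^ 'd \<Rightarrow> real ^ 'd \<Rightarrow> real ^ 'd" where
  "nonlocal_grad \<alpha> w x y = (w y - w x) *\<^sub>R \<alpha> x y"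

(* S is the extended domain.  Where the integrand is integrable, the principal value is the ordinary
   integral. *)
definition nonlocal_diffusion ::
  "(real ^ 'd \<Rightarrow> real ^ 'd \<Rightarrow> real ^ 'd) \<Rightarrow> (real ^ 'd) set \<Rightarrow> (real ^ 'd \<Rightarrow> real) \<Rightarrow> real ^ 'd \<Rightarrow> real" where
  "nonlocal_diffusion \<alpha> S w x = 2 * pv_integral (\<lambda>y. (w y - w x) * ker \<alpha> x y) S x"

(* w \<mapsto> N(G w). *)
definition nonlocal_neumann ::
  "(real ^ 'd \<Rightarrow> real ^ 'd \<Rightarrow> real ^ 'd) \<Rightarrow> (real ^ 'd) set \<Rightarrow> (real ^ 'd \<Rightarrow> real) \<Rightarrow> real ^ 'd \<Rightarrow> real" where
  "nonlocal_neumann \<alpha> S w x = - (2 * pv_integral (\<lambda>y. (w x - w y) * ker \<alpha> x y) S x)"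

section \<open>Energy spaces\<close>

definition energy ::
  "(real ^ 'd \<Rightarrow> real ^ 'd \<Rightarrow> real ^ 'd) \<Rightarrow> (real ^ 'd) set \<Rightarrow> (real ^ 'd \<Rightarrow> real) \<Rightarrow> ennreal" where
  "energy \<alpha> S v =
    (\<integral>\<^sup>+ x \<in> S. (\<integral>\<^sup>+ y \<in> S. ennreal ((norm (nonlocal_grad \<alpha> v x y))\<^sup>2) \<partial>lebesgue) \<partial>lebesgue) / 2"

definition energy_norm ::
  "(real ^ 'd \<Rightarrow> real ^ 'd \<Rightarrow> real ^ 'd) \<Rightarrow> (real ^ 'd) set \<Rightarrow> (real ^ 'd \<Rightarrow> real) \<Rightarrow> real" where
  "energy_norm \<alpha> S v = sqrt (enn2real (energy \<alpha> S v))"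

definition V_space ::
  "(real ^ 'd \<Rightarrow> real ^ 'd \<Rightarrow> real ^ 'd) \<Rightarrow> (real ^ 'd) set \<Rightarrow> (real ^ 'd \<Rightarrow> real) set" where
  "V_space \<alpha> S = {v. L2_on lebesgue S v \<and> energy \<alpha> S v < \<infinity>}"

definition Vc_space ::
  "(real ^ 'd \<Rightarrow> real ^ 'd \<Rightarrow> real ^ 'd) \<Rightarrow> (real ^ 'd) set \<Rightarrow> (real ^ 'd) set \<Rightarrow> (real ^ 'd \<Rightarrow> real) set" where
  "Vc_space \<alpha> S \<Omega>D = {v \<in> V_space \<alpha> S. AE x in lebesgue. x \<in> \<Omega>D \<longrightarrow> v x = 0}"

definition nonlocal_form ::
  "(real ^ 'd \<Rightarrow> real ^ 'd \<Rightarrow> real ^ 'd) \<Rightarrow> (real ^ 'd) set \<Rightarrow> (real ^ 'd \<Rightarrow> real) \<Rightarrow> (real ^ 'd \<Rightarrow> real) \<Rightarrow> real" where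
  "nonlocal_form \<alpha> S w z =
    (LINT x:S|lebesgue. LINT y:S|lebesgue. (w x - w y) * (z x - z y) * ker \<alpha> x y)"

(* A function that belongs to the dual of Vc via the L2 pairing. *)
definition in_dual ::
  "(real ^ 'd \<Rightarrow> real ^ 'd \<Rightarrow> real ^ 'd) \<Rightarrow> (real ^ 'd) set \<Rightarrow> (real ^ 'd) set \<Rightarrow> (real ^ 'd \<Rightarrow> real) \<Rightarrow> bool" where
  "in_dual \<alpha> S \<Omega>D s \<longleftrightarrow> set_borel_measurable lebesgue S s \<and>
    (\<forall>z \<in> Vc_space \<alpha> S \<Omega>D. set_integrable lebesgue S (\<lambda>x. s x * z x)) \<and>
    (\<exists>C. \<forall>z \<in> Vc_space \<alpha> S \<Omega>D.
       \<bar>LINT x:S|lebesgue. s x * z x\<bar> \<le> C * energy_norm \<alpha> S z)"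

section \<open>Standing assumptions\<close>

(* Antisymmetry forces the kernel to vanish on the diagonal, so its positivity is required off the
   diagonal only. *)
definition admissible_kernel ::
  "(real ^ 'd) set \<Rightarrow> real \<Rightarrow> (real ^ 'd \<Rightarrow> real ^ 'd \<Rightarrow> real ^ 'd) \<Rightarrow> bool" where
  "admissible_kernel \<Omega> \<epsilon> \<alpha> \<longleftrightarrow>
    (\<lambda>(x, y). \<alpha> x y) \<in> borel_measurable (lebesgue \<Otimes>\<^sub>M lebesgue) \<and>
    (\<forall>x y. \<alpha> x y = - \<alpha> y x) \<and>
    (\<forall>x \<in> \<Omega>. \<forall>y. 0 < norm (x - y) \<and> norm (x - y) < \<epsilon> \<longrightarrow> ker \<alpha> x y > 0) \<and>
    (\<forall>x \<in> \<Omega>. \<forall>y \<in> extended_domain \<Omega> \<epsilon>. norm (x - y) \<ge> \<epsilon> \<longrightarrow> ker \<alpha> x y = 0)"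

definition normalized_kernel ::
  "(real ^ 'd) set \<Rightarrow> real \<Rightarrow> (real ^ 'd \<Rightarrow> real ^ 'd \<Rightarrow> real ^ 'd) \<Rightarrow> bool" where
  "normalized_kernel \<Omega> \<epsilon> \<alpha> \<longleftrightarrow>
    (\<forall>p. polynomial_deg_le 3 p \<longrightarrow> (\<forall>x \<in> \<Omega>.
       pv_integrable (\<lambda>y. (p y - p x) * ker \<alpha> x y) (extended_domain \<Omega> \<epsilon>) x \<and>
       nonlocal_diffusion \<alpha> (extended_domain \<Omega> \<epsilon>) p x = laplacian p x))"

definition domain_decomposition ::
  "(real ^ 'd) set \<Rightarrow> real \<Rightarrow> (real ^ 'd) set \<Rightarrow> (real ^ 'd) set \<Rightarrow> (real ^ 'd) set \<Rightarrow> (real ^ 'd) set \<Rightarrow> bool" where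
  "domain_decomposition \<Omega> \<epsilon> \<Omega>N \<Omega>D \<Gamma>N \<Gamma>D \<longleftrightarrow>
    \<Omega>N \<in> sets lebesgue \<and> \<Omega>D \<in> sets lebesgue \<and>
    interaction_domain \<Omega> \<epsilon> = \<Omega>N \<union> \<Omega>D \<and> \<Omega>N \<inter> \<Omega>D = {} \<and>
    \<Gamma>N \<in> sets surface_measure \<and> \<Gamma>D \<in> sets surface_measure \<and>
    frontier (extended_domain \<Omega> \<epsilon>) = \<Gamma>N \<union> \<Gamma>D \<and> \<Gamma>N \<inter> \<Gamma>D = {} \<and>
    \<Gamma>N \<subseteq> closure \<Omega>N \<and> \<Gamma>D \<subseteq> closure \<Omega>D"

(* P w z is the duality pairing of N(G w) on \<Omega>N with z \<in> Vc, for w in C^4: a bounded linear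
   functional of z, given by the integral of N(G w) z over \<Omega>N whenever that integral makes sense. *)
definition neumann_pairing ::
  "(real ^ 'd \<Rightarrow> real ^ 'd \<Rightarrow> real ^ 'd) \<Rightarrow> (real ^ 'd) set \<Rightarrow> (real ^ 'd) set \<Rightarrow> (real ^ 'd) set \<Rightarrow>
   ((real ^ 'd \<Rightarrow> real) \<Rightarrow> (real ^ 'd \<Rightarrow> real) \<Rightarrow> real) \<Rightarrow> bool" where
  "neumann_pairing \<alpha> S \<Omega>N \<Omega>D P \<longleftrightarrow> (\<forall>w. C_up_to_boundary 4 S w \<longrightarrow>
    (\<forall>z1 \<in> Vc_space \<alpha> S \<Omega>D. \<forall>z2 \<in> Vc_space \<alpha> S \<Omega>D. \<forall>a b.
       P w (\<lambda>x. a * z1 x + b * z2 x) = a * P w z1 + b * P w z2) \<and>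
    (\<exists>C. \<forall>z \<in> Vc_space \<alpha> S \<Omega>D. \<bar>P w z\<bar> \<le> C * energy_norm \<alpha> S z) \<and>
    (\<forall>z \<in> Vc_space \<alpha> S \<Omega>D.
       (AE x in lebesgue. x \<in> \<Omega>N \<longrightarrow> pv_integrable (\<lambda>y. (w x - w y) * ker \<alpha> x y) S x) \<longrightarrow>
       set_integrable lebesgue \<Omega>N (\<lambda>x. nonlocal_neumann \<alpha> S w x * z x) \<longrightarrow>
       P w z = (LINT x:\<Omega>N|lebesgue. nonlocal_neumann \<alpha> S w x * z x)))"

definition green_identity ::
  "(real ^ 'd \<Rightarrow> real ^ 'd \<Rightarrow> real ^ 'd) \<Rightarrow> (real ^ 'd) set \<Rightarrow> (real ^ 'd) set \<Rightarrow> (real ^ 'd) set \<Rightarrow>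
   ((real ^ 'd \<Rightarrow> real) \<Rightarrow> (real ^ 'd \<Rightarrow> real) \<Rightarrow> real) \<Rightarrow> bool" where
  "green_identity \<alpha> \<Omega> S \<Omega>D P \<longleftrightarrow>
    (\<forall>w z. C_up_to_boundary 4 S w \<longrightarrow> z \<in> Vc_space \<alpha> S \<Omega>D \<longrightarrow>
       nonlocal_form \<alpha> S w z = - (LINT x:\<Omega>|lebesgue. nonlocal_diffusion \<alpha> S w x * z x) - P w z)"

section \<open>Data, local and nonlocal problems\<close>

(* vn is the restriction to \<Omega>D of an element of V; tr is its trace on \<Gamma>D. *)
definition dirichlet_datum ::
  "(real ^ 'd \<Rightarrow> real ^ 'd \<Rightarrow> real ^ 'd) \<Rightarrow> (real ^ 'd) set \<Rightarrow> (real ^ 'd) set \<Rightarrow> (real ^ 'd) set \<Rightarrow>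
   (real ^ 'd \<Rightarrow> real) \<Rightarrow> (real ^ 'd \<Rightarrow> real) \<Rightarrow> bool" where
  "dirichlet_datum \<alpha> S \<Omega>D \<Gamma>D vn tr \<longleftrightarrow>
    (\<exists>v \<in> V_space \<alpha> S. AE x in lebesgue. x \<in> \<Omega>D \<longrightarrow> vn x = v x) \<and>
    H_half \<Gamma>D tr \<and>
    (AE p in surface_measure. p \<in> \<Gamma>D \<longrightarrow> has_trace_at \<Omega>D vn p (tr p))"

definition local_solution ::
  "(real ^ 'd) set \<Rightarrow> (real ^ 'd) set \<Rightarrow> (real ^ 'd) set \<Rightarrow> (real ^ 'd \<Rightarrow> real ^ 'd) \<Rightarrow>
   (real ^ 'd \<Rightarrow> real) \<Rightarrow> (real ^ 'd \<Rightarrow> real) \<Rightarrow> (real ^ 'd \<Rightarrow> real) \<Rightarrow> (real ^ 'd \<Rightarrow> real) \<Rightarrow> bool" where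
  "local_solution S \<Gamma>N \<Gamma>D \<nu> s gl tr u \<longleftrightarrow> C_up_to_boundary 4 S u \<and>
    (AE x in lebesgue. x \<in> S \<longrightarrow> - laplacian u x = s x) \<and>
    (AE p in surface_measure. p \<in> \<Gamma>N \<longrightarrow> - normal_deriv S u p (\<nu> p) = gl p) \<and>
    (AE p in surface_measure. p \<in> \<Gamma>D \<longrightarrow> u p = tr p)"

(* The Neumann datum g enters as the functional z \<mapsto> \<integral> g z over \<Omega>N (duality pairing). *)
definition nonlocal_weak_solution ::
  "(real ^ 'd \<Rightarrow> real ^ 'd \<Rightarrow> real ^ 'd) \<Rightarrow> (real ^ 'd) set \<Rightarrow> (real ^ 'd) set \<Rightarrow> (real ^ 'd) set \<Rightarrow>
   (real ^ 'd \<Rightarrow> real) \<Rightarrow> ((real ^ 'd \<Rightarrow> real) \<Rightarrow> real) \<Rightarrow> (real ^ 'd \<Rightarrow> real) \<Rightarrow> (real ^ 'd \<Rightarrow> real) \<Rightarrow> bool" where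
  "nonlocal_weak_solution \<alpha> \<Omega> S \<Omega>D s g vn u \<longleftrightarrow> u \<in> V_space \<alpha> S \<and>
    (AE x in lebesgue. x \<in> \<Omega>D \<longrightarrow> u x = vn x) \<and>
    (\<forall>z \<in> Vc_space \<alpha> S \<Omega>D.
       nonlocal_form \<alpha> S u z = g z + (LINT x:\<Omega>|lebesgue. s x * z x))"

end

(* The error e between the nonlocal and the local solution is an admissible test function.  The weak
   equation and Green's identity give 2 |||e|||^2 = int_Omega (L u_l - Delta u_l) e.  At a point x of
   Omega, L is exact on the cubic Taylor polynomial of u_l, and the remainder is at most
   const * eps^2 * |y - x|^2 times the sup norm of D^4 u_l inside the support of the kernel; as L is
   also exact on y |-> |y - x|^2, the kernel has second moment d, and so the integrand has size
   const * eps^2 independently of the kernel.  Cauchy-Schwarz and the Poincare inequality conclude. *)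
theory Submission
  imports Defs
begin

section \<open>Taylor expansion in several variables\<close>

text \<open>The kernel may be too singular to be integrable, so the operators are principal values,
  and no quantitative bound on the kernel is assumed. Exactness on quadratics supplies one: a
  nonnegative integrand that has a principal value converges absolutely, so
  \<open>|y - x|^2 * ker \<alpha> x y\<close> is integrable, with an integral that does not depend
  on \<epsilon>. The Taylor remainder is dominated by it, and only the cubic part, whose value is
  known, stays a principal value. The error vanishes on the Dirichlet region because
  \<open>ul\<close> and \<open>vn\<close> are taken to agree almost everywhere on
  \<open>\<Omega>D\<close>, not only in the sense of traces on \<open>\<Gamma>D\<close>. The
  constant is \<open>Cpn^2 * sqrt |\<Omega>| * d^5 / 24\<close>. Taylor gives
  \<open>d^4 / 4!\<close>, as the l1 norm of \<open>y - x\<close> is at most d times the Euclidean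
  norm; the prefactor of the diffusion operator gives 2, the second moment gives d, and the 2 in
  \<open>2 |||e|||^2\<close> is divided out. Cauchy-Schwarz on \<Omega> gives
  \<open>sqrt |\<Omega>|\<close>. One factor \<open>Cpn\<close> comes from estimating the L2 norm of
  the error by its energy norm, the other stands in the claim.\<close>

lemma has_derivative_line:
  fixes f :: "'a::real_normed_vector \<Rightarrow> real"
  assumes "(f has_derivative D) (at (x + t *\<^sub>R h))"
  shows "((\<lambda>t. f (x + t *\<^sub>R h)) has_real_derivative D h) (at t)"
proof -
  interpret D: bounded_linear D
    using assms by (rule has_derivative_bounded_linear)
  have "((\<lambda>t. x + t *\<^sub>R h) has_derivative (\<lambda>s. s *\<^sub>R h)) (at t)"
    by (auto intro!: derivative_eq_intros)
  from has_derivative_compose[OF this assms]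
  show ?thesis
    by (simp add: D.scaleR has_field_derivative_def mult.commute[of _ "D h"])
qed

lemma partial_deriv_eq_derivative:
  assumes "(f has_derivative D) (at z)"
  shows "partial_deriv i f z = D (axis i 1)"
  using has_derivative_line[of f D z 0 "axis i 1"] assms
  unfolding partial_deriv_def by (intro DERIV_imp_deriv) simp

lemma DERIV_along_line:
  fixes f :: "real ^ 'd \<Rightarrow> real"
  assumes "f differentiable at (x + t *\<^sub>R h)"
  shows "((\<lambda>t. f (x + t *\<^sub>R h)) has_real_derivative
           (\<Sum>i\<in>UNIV. h $ i * partial_deriv i f (x + t *\<^sub>R h))) (at t)"
proof -
  obtain D where D: "(f has_derivative D) (at (x + t *\<^sub>R h))"
    using assms by (auto simp: differentiable_def)
  interpret D: bounded_linear D
    using D by (rule has_derivative_bounded_linear)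
  have "D h = D (\<Sum>i\<in>UNIV. h $ i *\<^sub>R axis i 1)"
    using basis_expansion[of h] by (simp add: scalar_mult_eq_scaleR)
  also have "\<dots> = (\<Sum>i\<in>UNIV. h $ i * partial_deriv i f (x + t *\<^sub>R h))"
    by (simp add: D.sum D.scaleR partial_deriv_eq_derivative[OF D])
  finally show ?thesis
    using has_derivative_line[OF D] by simp
qed

(* (h . grad)^k applied to D_js u at z: the recursion avoids sums over multi-indices. *)
primrec iterated_directional ::
  "(real ^ 'd \<Rightarrow> real) \<Rightarrow> real ^ 'd \<Rightarrow> nat \<Rightarrow> 'd list \<Rightarrow> real ^ 'd \<Rightarrow> real" where
  "iterated_directional u h 0 js z = partial_derivs js u z"
| "iterated_directional u h (Suc k) js z =
     (\<Sum>i\<in>UNIV. h $ i * iterated_directional u h k (i # js) z)"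

text \<open>The strict inequality \<open>k + length js < n\<close> keeps every index list reached by
  the recursion among those whose partial derivative is assumed differentiable.\<close>

lemma DERIV_iterated_directional:
  assumes "\<And>js. length js < n \<Longrightarrow> partial_derivs js u differentiable at (x + t *\<^sub>R h)"
    and "k + length js < n"
  shows "((\<lambda>t. iterated_directional u h k js (x + t *\<^sub>R h)) has_real_derivative
           iterated_directional u h (Suc k) js (x + t *\<^sub>R h)) (at t)"
  using assms(2)
proof (induction k arbitrary: js)
  case 0
  then show ?case
    using DERIV_along_line[OF assms(1), of js] by simp
next
  case (Suc k)
  have "((\<lambda>t. \<Sum>i\<in>UNIV. h $ i * iterated_directional u h k (i # js) (x + t *\<^sub>R h)) has_real_derivative
          (\<Sum>i\<in>UNIV. h $ i * iterated_directional u h (Suc k) (i # js) (x + t *\<^sub>R h))) (at t)"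
    using Suc by (intro DERIV_sum DERIV_cmult) auto
  then show ?case by simp
qed

text \<open>Each directional step costs one factor, the l1 norm of \<open>h\<close>; the bound
  \<open>M\<close> enters only when the index list has reached full length \<open>n\<close>.\<close>

lemma iterated_directional_bound:
  assumes "\<And>js. length js = n \<Longrightarrow> \<bar>partial_derivs js u z\<bar> \<le> M"
    and "k + length js = n"
  shows "\<bar>iterated_directional u h k js z\<bar> \<le> (\<Sum>i\<in>UNIV. \<bar>h $ i\<bar>) ^ k * M"
  using assms(2)
proof (induction k arbitrary: js)
  case 0
  then show ?case using assms(1) by simp
next
  case (Suc k)
  have "\<bar>iterated_directional u h (Suc k) js z\<bar>
      \<le> (\<Sum>i\<in>UNIV. \<bar>h $ i\<bar> * \<bar>iterated_directional u h k (i # js) z\<bar>)"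
    by (simp flip: abs_mult)
  also have "\<dots> \<le> (\<Sum>i\<in>UNIV. \<bar>h $ i\<bar> * ((\<Sum>i\<in>UNIV. \<bar>h $ i\<bar>) ^ k * M))"
    using Suc by (intro sum_mono mult_left_mono) auto
  also have "\<dots> = (\<Sum>i\<in>UNIV. \<bar>h $ i\<bar>) ^ Suc k * M"
    by (simp add: sum_distrib_right mult.assoc)
  finally show ?case .
qed

text \<open>In a coordinate direction only the repeated index survives. This makes the Taylor
  polynomial explicit along the axes, where its Laplacian is computed.\<close>

lemma iterated_directional_axis:
  "iterated_directional u (t *\<^sub>R axis i 1) k js z = t ^ k * partial_derivs (replicate k i @ js) u z"
proof (induction k arbitrary: js)
  case (Suc k)
  have "iterated_directional u (t *\<^sub>R axis i 1) (Suc k) js z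
      = (\<Sum>j\<in>UNIV. if j = i then t * iterated_directional u (t *\<^sub>R axis i 1) k (i # js) z else 0)"
    by (intro trans[OF iterated_directional.simps(2)] sum.cong) (auto simp: axis_def[of i 1])
  then show ?case
    by (simp add: Suc.IH replicate_app_Cons_same)
qed simp

section \<open>Polynomials of bounded degree\<close>

lemma finite_multi_indices: "finite {k :: 'd::finite \<Rightarrow> nat. (\<Sum>i\<in>UNIV. k i) \<le> m}"
proof (rule finite_subset)
  show "{k :: 'd \<Rightarrow> nat. (\<Sum>i\<in>UNIV. k i) \<le> m} \<subseteq> PiE UNIV (\<lambda>_. {..m})"
  proof
    fix k :: "'d \<Rightarrow> nat" assume "k \<in> {k. (\<Sum>i\<in>UNIV. k i) \<le> m}"
    then have "k i \<le> m" for i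
      using member_le_sum[of i UNIV k] by simp
    then show "k \<in> PiE UNIV (\<lambda>_. {..m})" by auto
  qed
  show "finite (PiE (UNIV :: 'd set) (\<lambda>_. {..m}))"
    by (intro finite_PiE) auto
qed

lemma polynomial_deg_le_const: "polynomial_deg_le m (\<lambda>_ :: real ^ 'd. a)"
proof -
  have "(\<Sum>k | (\<Sum>i\<in>UNIV. k i) \<le> m. (if k = (\<lambda>_. 0) then a else 0) * (\<Prod>i\<in>UNIV. (x $ i) ^ k i))
      = (\<Sum>k :: 'd \<Rightarrow> nat | (\<Sum>i\<in>UNIV. k i) \<le> m. if k = (\<lambda>_. 0) then a else 0)" for x :: "real ^ 'd"
    by (intro sum.cong) auto
  also have "\<dots> = a"
    using finite_multi_indices by (subst sum.delta) auto
  finally show ?thesis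
    unfolding polynomial_deg_le_def by (intro exI[of _ "\<lambda>k. if k = (\<lambda>_. 0) then a else 0"]) auto
qed

lemma polynomial_deg_le_add:
  assumes "polynomial_deg_le m p" "polynomial_deg_le m q"
  shows "polynomial_deg_le m (\<lambda>x. p x + q x)"
proof -
  obtain c d where "p = (\<lambda>x. \<Sum>k | (\<Sum>i\<in>UNIV. k i) \<le> m. c k * (\<Prod>i\<in>UNIV. (x $ i) ^ k i))"
    "q = (\<lambda>x. \<Sum>k | (\<Sum>i\<in>UNIV. k i) \<le> m. d k * (\<Prod>i\<in>UNIV. (x $ i) ^ k i))"
    using assms unfolding polynomial_deg_le_def by blast
  then show ?thesis
    unfolding polynomial_deg_le_def
    by (intro exI[of _ "\<lambda>k. c k + d k"]) (simp add: sum.distrib distrib_right)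
qed

lemma polynomial_deg_le_cmult:
  assumes "polynomial_deg_le m p"
  shows "polynomial_deg_le m (\<lambda>x. a * p x)"
proof -
  obtain c where "p = (\<lambda>x. \<Sum>k | (\<Sum>i\<in>UNIV. k i) \<le> m. c k * (\<Prod>i\<in>UNIV. (x $ i) ^ k i))"
    using assms unfolding polynomial_deg_le_def by blast
  then show ?thesis
    unfolding polynomial_deg_le_def
    by (intro exI[of _ "\<lambda>k. a * c k"]) (simp add: sum_distrib_left mult.assoc)
qed

lemma polynomial_deg_le_sum:
  assumes "finite I" "\<And>i. i \<in> I \<Longrightarrow> polynomial_deg_le m (p i)"
  shows "polynomial_deg_le m (\<lambda>x. \<Sum>i\<in>I. p i x)"
  using assms
  by (induction I rule: finite_induct) (auto intro: polynomial_deg_le_const polynomial_deg_le_add)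

lemma polynomial_deg_le_mono:
  assumes "polynomial_deg_le m p" "m \<le> n"
  shows "polynomial_deg_le n p"
proof -
  obtain c where p: "p = (\<lambda>x. \<Sum>k | (\<Sum>i\<in>UNIV. k i) \<le> m. c k * (\<Prod>i\<in>UNIV. (x $ i) ^ k i))"
    using assms unfolding polynomial_deg_le_def by blast
  have "p x = (\<Sum>k | (\<Sum>i\<in>UNIV. k i) \<le> n.
      (if (\<Sum>i\<in>UNIV. k i) \<le> m then c k else 0) * (\<Prod>i\<in>UNIV. (x $ i) ^ k i))" for x
    unfolding p using assms(2)
    by (intro sum.mono_neutral_cong_left) (auto intro: finite_multi_indices)
  then show ?thesis
    unfolding polynomial_deg_le_def
    by (intro exI[of _ "\<lambda>k. if (\<Sum>i\<in>UNIV. k i) \<le> m then c k else 0"] ext)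
qed

lemma polynomial_deg_le_coordinate_mult:
  fixes p :: "real ^ 'd \<Rightarrow> real"
  assumes "polynomial_deg_le m p"
  shows "polynomial_deg_le (Suc m) (\<lambda>x. x $ j * p x)"
proof -
  obtain c where p: "p = (\<lambda>x. \<Sum>k | (\<Sum>i\<in>UNIV. k i) \<le> m. c k * (\<Prod>i\<in>UNIV. (x $ i) ^ k i))"
    using assms unfolding polynomial_deg_le_def by blast
  \<comment> \<open>Multiplication by \<open>x $ j\<close> raises the j-th exponent by one. This map
    of exponents is injective, so the new coefficients are the old ones carried over by
    \<open>inv up\<close>, and zero off its range.\<close>
  define up where "up = (\<lambda>k :: 'd \<Rightarrow> nat. k(j := Suc (k j)))"
  have sum_up: "(\<Sum>i\<in>UNIV. up k i) = Suc (\<Sum>i\<in>UNIV. k i)" for k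
    by (subst (1 2) sum.remove[of _ j]) (auto simp: up_def)
  have prod_up: "(\<Prod>i\<in>UNIV. (x $ i) ^ up k i) = x $ j * (\<Prod>i\<in>UNIV. (x $ i) ^ k i)" for k x
    by (subst (1 2) prod.remove[of _ j]) (auto simp: up_def mult.assoc)
  have inj: "inj up"
  proof (rule injI)
    fix k l assume "up k = up l"
    then have eq: "up k i = up l i" for i by simp
    have "k i = l i" for i
      using eq[of i] by (simp add: up_def split: if_splits)
    then show "k = l" by (rule ext)
  qed
  have "x $ j * p x = (\<Sum>k | (\<Sum>i\<in>UNIV. k i) \<le> Suc m.
      (if k \<in> range up then c (inv up k) else 0) * (\<Prod>i\<in>UNIV. (x $ i) ^ k i))" for x
  proof -
    have "x $ j * p x = (\<Sum>k | (\<Sum>i\<in>UNIV. k i) \<le> m. c k * (\<Prod>i\<in>UNIV. (x $ i) ^ up k i))"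
      unfolding p prod_up by (simp add: sum_distrib_left mult_ac)
    also have "\<dots> = (\<Sum>k \<in> up ` {k. (\<Sum>i\<in>UNIV. k i) \<le> m}.
        c (inv up k) * (\<Prod>i\<in>UNIV. (x $ i) ^ k i))"
      using inj by (subst sum.reindex) (auto intro: inj_on_subset)
    also have "\<dots> = (\<Sum>k | (\<Sum>i\<in>UNIV. k i) \<le> Suc m.
        (if k \<in> range up then c (inv up k) else 0) * (\<Prod>i\<in>UNIV. (x $ i) ^ k i))"
      using finite_multi_indices[of "Suc m"]
      by (intro sum.mono_neutral_cong_left) (auto simp: sum_up)
    finally show ?thesis .
  qed
  then show ?thesis
    unfolding polynomial_deg_le_def
    by (intro exI[of _ "\<lambda>k. if k \<in> range up then c (inv up k) else 0"]) auto
qed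

lemma polynomial_deg_le_shifted_mult:
  fixes p :: "real ^ 'd \<Rightarrow> real"
  assumes "polynomial_deg_le m p"
  shows "polynomial_deg_le (Suc m) (\<lambda>y. (y - x) $ j * p y)"
  using polynomial_deg_le_add[OF polynomial_deg_le_coordinate_mult[OF assms]
      polynomial_deg_le_cmult[OF polynomial_deg_le_mono[OF assms]], of j "- (x $ j)"]
  by (simp add: algebra_simps)

lemma polynomial_deg_le_iterated_directional:
  "polynomial_deg_le k (\<lambda>y. iterated_directional u (y - x) k js x)"
proof (induction k arbitrary: js)
  case 0
  then show ?case by (simp add: polynomial_deg_le_const)
next
  case (Suc k)
  show ?case
    unfolding iterated_directional.simps
    by (intro polynomial_deg_le_sum polynomial_deg_le_shifted_mult Suc) simp
qed

section \<open>Taylor polynomials and their Laplacian\<close>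

lemma deriv_translate: "deriv (\<lambda>s. g (t + s)) 0 = deriv g (t :: real)"
  using deriv_shift_0[of g t] by (simp add: o_def)

text \<open>Reduces the Laplacian at a point to second derivatives of one-variable functions, where
  explicit formulas can be differentiated.\<close>

lemma partial_derivs_twice:
  "partial_derivs [i, i] p x = deriv (deriv (\<lambda>t. p (x + t *\<^sub>R axis i 1))) 0"
proof -
  have "partial_deriv i p (x + t *\<^sub>R axis i 1) = deriv (\<lambda>t. p (x + t *\<^sub>R axis i 1)) t" for t
    unfolding partial_deriv_def
    by (subst deriv_translate[symmetric]) (simp add: algebra_simps)
  then show ?thesis
    by (simp add: partial_deriv_def)
qed

text \<open>The index \<open>n\<close> counts terms, so the degree is at most \<open>n - 1\<close>
  and the cubic used for the consistency estimate is \<open>taylor_poly 4\<close>.\<close>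

definition taylor_poly :: "nat \<Rightarrow> (real ^ 'd \<Rightarrow> real) \<Rightarrow> real ^ 'd \<Rightarrow> real ^ 'd \<Rightarrow> real" where
  "taylor_poly n u x y = (\<Sum>m<n. iterated_directional u (y - x) m [] x / fact m)"

lemma polynomial_deg_le_taylor_poly: "polynomial_deg_le n (taylor_poly (Suc n) u x)"
  unfolding taylor_poly_def divide_inverse
  by (subst mult.commute, intro polynomial_deg_le_sum polynomial_deg_le_cmult)
     (auto intro: polynomial_deg_le_mono[OF polynomial_deg_le_iterated_directional])

lemma taylor_poly_centre: "taylor_poly (Suc n) u x x = u x"
proof -
  have "iterated_directional u 0 m [] x = (if m = 0 then u x else 0)" for m
    by (cases m) auto
  then have "taylor_poly (Suc n) u x x = (\<Sum>m<Suc n. if m = 0 then u x else 0)"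
    unfolding taylor_poly_def by (intro sum.cong) auto
  then show ?thesis by simp
qed

text \<open>Along an axis through the centre the polynomial is an explicit cubic in \<open>t\<close>
  whose coefficients are the pure derivatives \<open>a m\<close> over factorials, and its second
  derivative at 0 is \<open>a 2\<close>. Hence exactness of the nonlocal operator on this cubic
  already produces the Laplacian of \<open>u\<close>.\<close>

lemma laplacian_taylor_poly: "laplacian (taylor_poly 4 u x) x = laplacian u x"
proof -
  have "partial_derivs [i, i] (taylor_poly 4 u x) x = partial_derivs [i, i] u x" for i
  proof -
    define a where "a = (\<lambda>m. partial_derivs (replicate m i) u x)"
    have "taylor_poly 4 u x (x + t *\<^sub>R axis i 1) = a 0 + a 1 * t + a 2 * t ^ 2 / 2 + a 3 * t ^ 3 / 6" for t
      unfolding taylor_poly_def a_def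
      by (simp add: iterated_directional_axis eval_nat_numeral mult_ac)
    moreover have "deriv (\<lambda>t. a 0 + a 1 * t + a 2 * t ^ 2 / 2 + a 3 * t ^ 3 / 6)
        = (\<lambda>t. a 1 + a 2 * t + a 3 * t ^ 2 / 2)"
      by (intro ext DERIV_imp_deriv) (auto intro!: derivative_eq_intros)
    moreover have "deriv (\<lambda>t. a 1 + a 2 * t + a 3 * t ^ 2 / 2) 0 = a 2"
      by (intro DERIV_imp_deriv) (auto intro!: derivative_eq_intros)
    moreover have "a 2 = partial_derivs [i, i] u x"
      by (simp add: a_def eval_nat_numeral)
    ultimately show ?thesis
      by (simp add: partial_derivs_twice del: partial_derivs.simps)
  qed
  then show ?thesis by (simp add: laplacian_def del: partial_derivs.simps)
qed

lemma taylor_poly_remainder: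
  fixes x y :: "real ^ 'd"
  assumes "convex B" "x \<in> B" "y \<in> B" "n > 0"
    and "\<And>js z. length js < n \<Longrightarrow> z \<in> B \<Longrightarrow> partial_derivs js u differentiable at z"
    and bound: "\<And>js z. length js = n \<Longrightarrow> z \<in> B \<Longrightarrow> \<bar>partial_derivs js u z\<bar> \<le> M"
  shows "\<bar>u y - taylor_poly n u x y\<bar> \<le> (real CARD('d) * norm (y - x)) ^ n * M / fact n"
proof -
  define h where "h = y - x"
  have line: "x + t *\<^sub>R h \<in> B" if "0 \<le> t" "t \<le> 1" for t
    using convexD_alt[OF assms(1-3) that] by (simp add: h_def algebra_simps)
  \<comment> \<open>One-variable Maclaurin formula with Lagrange remainder for
    \<open>t \<mapsto> u (x + t *\<^sub>R h)\<close>, evaluated at \<open>t = 1\<close>; convexity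
    of \<open>B\<close> keeps the segment where \<open>u\<close> is differentiable.\<close>
  have "\<exists>t. 0 < t \<and> t < 1 \<and> u (x + 1 *\<^sub>R h) =
      (\<Sum>m<n. iterated_directional u h m [] (x + 0 *\<^sub>R h) / fact m * 1 ^ m) +
      iterated_directional u h n [] (x + t *\<^sub>R h) / fact n * 1 ^ n"
    using assms(4,5) line
    by (intro Maclaurin) (auto simp del: iterated_directional.simps(2) intro!: DERIV_iterated_directional[where n = n])
  then obtain t where t: "0 < t" "t < 1"
    and u: "u y = taylor_poly n u x y + iterated_directional u h n [] (x + t *\<^sub>R h) / fact n"
    by (auto simp: taylor_poly_def h_def)
  have M: "\<bar>partial_derivs js u (x + t *\<^sub>R h)\<bar> \<le> M" if "length js = n" for js
    using bound[OF that line] t by simp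
  \<comment> \<open>Any index list of length \<open>n\<close> serves here; the bound at a point of
    the segment forces \<open>M\<close> to be nonnegative.\<close>
  then have "0 \<le> M"
    using order_trans[OF abs_ge_zero M[of "replicate n undefined"]] by simp
  have "(\<Sum>i\<in>UNIV. \<bar>h $ i\<bar>) \<le> real CARD('d) * norm h"
    using sum_mono[of UNIV "\<lambda>i. \<bar>h $ i\<bar>" "\<lambda>_. norm h"] component_le_norm_cart[of h] by simp
  then have "(\<Sum>i\<in>UNIV. \<bar>h $ i\<bar>) ^ n * M \<le> (real CARD('d) * norm h) ^ n * M"
    using \<open>0 \<le> M\<close> by (intro mult_right_mono power_mono) (auto intro: sum_nonneg)
  moreover have "\<bar>iterated_directional u h n [] (x + t *\<^sub>R h)\<bar> \<le> (\<Sum>i\<in>UNIV. \<bar>h $ i\<bar>) ^ n * M"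
    using M by (intro iterated_directional_bound) auto
  ultimately show ?thesis
    unfolding u h_def by (simp add: divide_right_mono)
qed

lemma polynomial_deg_le_norm_power2: "polynomial_deg_le 2 (\<lambda>y :: real ^ 'd. (norm (y - x))\<^sup>2)"
proof -
  have "polynomial_deg_le (Suc (Suc 0)) (\<lambda>y. \<Sum>i\<in>UNIV. (y - x) $ i * ((y - x) $ i * 1))"
    by (intro polynomial_deg_le_sum polynomial_deg_le_shifted_mult polynomial_deg_le_const) simp
  then show ?thesis
    by (simp add: power2_norm_eq_inner inner_vec_def flip: numeral_2_eq_2)
qed

lemma laplacian_norm_power2:
  "laplacian (\<lambda>y :: real ^ 'd. (norm (y - x))\<^sup>2) x = 2 * real CARD('d)"
proof -
  have "partial_derivs [i, i] (\<lambda>y. (norm (y - x))\<^sup>2) x = 2" for i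
  proof -
    have "deriv (\<lambda>t. t\<^sup>2) = (\<lambda>t. 2 * t :: real)"
      by (intro ext DERIV_imp_deriv) (auto intro!: derivative_eq_intros)
    moreover have "deriv (\<lambda>t. 2 * t) (0 :: real) = 2"
      by (intro DERIV_imp_deriv) (auto intro!: derivative_eq_intros)
    ultimately show ?thesis
      by (simp add: partial_derivs_twice del: partial_derivs.simps)
  qed
  then show ?thesis by (simp add: laplacian_def del: partial_derivs.simps)
qed

section \<open>Principal values and consistency\<close>

lemma sigma_finite_lebesgue: "sigma_finite_measure (lebesgue :: 'a::euclidean_space measure)"
proof
  obtain A :: "'a set set" where A: "countable A" "A \<subseteq> sets lborel" "\<Union>A = space lborel"
      "\<forall>a\<in>A. emeasure lborel a \<noteq> \<infinity>"
    using lborel.sigma_finite_countable by auto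
  then have "A \<subseteq> sets lebesgue" "\<Union>A = space lebesgue" "\<forall>a\<in>A. emeasure lebesgue a \<noteq> \<infinity>"
    by (auto simp: subset_iff)
  with A(1) show "\<exists>A :: 'a set set. countable A \<and> A \<subseteq> sets lebesgue \<and> \<Union>A = space lebesgue \<and>
      (\<forall>a\<in>A. emeasure lebesgue a \<noteq> \<infinity>)"
    by blast
qed

interpretation lebesgue: sigma_finite_measure "lebesgue :: 'a::euclidean_space measure"
  by (rule sigma_finite_lebesgue)

interpretation lebesgue_pair: pair_sigma_finite
  "lebesgue :: 'a::euclidean_space measure" "lebesgue :: 'b::euclidean_space measure" ..

lemma AE_lebesgue_neq: "AE y in lebesgue. y \<noteq> (x :: 'a::euclidean_space)"
  by (rule AE_I'[of "{x}"]) (auto simp flip: negligible_iff_null_sets)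

lemma set_borel_measurable_lebesgue_continuous:
  fixes f :: "'a::euclidean_space \<Rightarrow> real"
  assumes "open S" "continuous_on S f"
  shows "set_borel_measurable lebesgue S f"
  unfolding set_borel_measurable_def
  by (rule measurable_completion)
     (use borel_measurable_continuous_on_indicator[OF _ assms(2)] assms(1) in simp)

section \<open>Principal value integrals\<close>

lemma has_pv_integral_unique:
  assumes "has_pv_integral f I S x" "has_pv_integral f J S x"
  shows "I = J"
proof (rule tendsto_unique[OF trivial_limit_at_right_real])
  show "((\<lambda>r. LINT y:S - ball x r|lebesgue. f y) \<longlongrightarrow> I) (at_right 0)"
    using assms(1) by (simp add: has_pv_integral_def)
  show "((\<lambda>r. LINT y:S - ball x r|lebesgue. f y) \<longlongrightarrow> J) (at_right 0)"
    using assms(2) by (simp add: has_pv_integral_def)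
qed

lemma pv_integral_eq:
  assumes "has_pv_integral f I S x"
  shows "pv_integral f S x = I"
  unfolding pv_integral_def using assms by (rule the_equality) (rule has_pv_integral_unique[OF _ assms])

lemma has_pv_integral_pv_integral:
  assumes "pv_integrable f S x"
  shows "has_pv_integral f (pv_integral f S x) S x"
proof -
  obtain I where "has_pv_integral f I S x"
    using assms unfolding pv_integrable_def ..
  then show ?thesis by (simp add: pv_integral_eq)
qed

lemma has_pv_integral_add:
  assumes "has_pv_integral f I S x" "has_pv_integral g J S x"
  shows "has_pv_integral (\<lambda>y. f y + g y) (I + J) S x"
  unfolding has_pv_integral_def
proof (intro conjI allI impI)
  show "set_integrable lebesgue (S - ball x r) (\<lambda>y. f y + g y)" if "r > 0" for r
    using assms that unfolding has_pv_integral_def by (intro set_integral_add) auto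
  have "((\<lambda>r. (LINT y:S - ball x r|lebesgue. f y) + (LINT y:S - ball x r|lebesgue. g y))
      \<longlongrightarrow> I + J) (at_right 0)"
    using assms unfolding has_pv_integral_def by (intro tendsto_add) auto
  moreover have "\<forall>\<^sub>F r in at_right 0. (LINT y:S - ball x r|lebesgue. f y) + (LINT y:S - ball x r|lebesgue. g y)
      = (LINT y:S - ball x r|lebesgue. f y + g y)"
    using assms eventually_at_right_less[of "0 :: real"] unfolding has_pv_integral_def
    by (auto elim!: eventually_mono simp: set_integral_add)
  ultimately show "((\<lambda>r. LINT y:S - ball x r|lebesgue. f y + g y) \<longlongrightarrow> I + J) (at_right 0)"
    by (rule Lim_transform_eventually)
qed

text \<open>A ball shrinking to \<open>x\<close> eventually misses any \<open>y\<close> other than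
  \<open>x\<close>, so the truncated integrand is eventually constant there; the centre itself is a
  null set.\<close>

lemma indicator_minus_ball_tendsto:
  fixes f :: "'a::metric_space \<Rightarrow> real"
  assumes "X \<longlonglongrightarrow> 0" "y \<noteq> x"
  shows "(\<lambda>n. indicator (S - ball x (X n)) y *\<^sub>R f y) \<longlonglongrightarrow> indicator S y *\<^sub>R f y"
proof (rule tendsto_eventually)
  have "\<forall>\<^sub>F n in sequentially. X n < dist x y"
    using assms by (intro order_tendstoD) auto
  then show "\<forall>\<^sub>F n in sequentially. indicator (S - ball x (X n)) y *\<^sub>R f y = indicator S y *\<^sub>R f y"
    by eventually_elim (auto simp: indicator_def)
qed

text \<open>Dominated convergence with majorant \<open>|f|\<close> on \<open>S\<close>, tested along
  sequences of radii. It lets the Taylor remainder enter a principal value as an ordinary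
  integral.\<close>

lemma has_pv_integral_set_integrable:
  assumes "S \<in> sets lebesgue" "set_integrable lebesgue S f"
  shows "has_pv_integral f (LINT y:S|lebesgue. f y) S x"
  unfolding has_pv_integral_def
proof (intro conjI allI impI)
  show "set_integrable lebesgue (S - ball x r) f" for r
    using assms by (intro set_integrable_subset[OF assms(2)]) auto
  show "((\<lambda>r. LINT y:S - ball x r|lebesgue. f y) \<longlongrightarrow> (LINT y:S|lebesgue. f y)) (at_right 0)"
    unfolding tendsto_at_iff_sequentially
  proof (intro allI impI)
    fix X :: "nat \<Rightarrow> real" assume "X \<longlonglongrightarrow> 0"
    show "((\<lambda>r. LINT y:S - ball x r|lebesgue. f y) \<circ> X) \<longlonglongrightarrow> (LINT y:S|lebesgue. f y)"
      unfolding set_lebesgue_integral_def o_def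
    proof (rule integral_dominated_convergence)
      show "integrable lebesgue (\<lambda>y. norm (indicator S y *\<^sub>R f y))"
        using assms(2) unfolding set_integrable_def by (rule integrable_norm)
      show "(\<lambda>y. indicator S y *\<^sub>R f y) \<in> borel_measurable lebesgue"
        using assms(2) unfolding set_integrable_def by (rule borel_measurable_integrable)
      show "(\<lambda>y. indicator (S - ball x (X n)) y *\<^sub>R f y) \<in> borel_measurable lebesgue" for n
      proof (rule borel_measurable_integrable)
        show "integrable lebesgue (\<lambda>y. indicator (S - ball x (X n)) y *\<^sub>R f y)"
          using assms(1) by (intro set_integrable_subset[OF assms(2), unfolded set_integrable_def]) auto
      qed
      show "AE y in lebesgue. (\<lambda>n. indicator (S - ball x (X n)) y *\<^sub>R f y) \<longlonglongrightarrow> indicator S y *\<^sub>R f y"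
        using AE_lebesgue_neq[of x] by eventually_elim (rule indicator_minus_ball_tendsto[OF \<open>X \<longlonglongrightarrow> 0\<close>])
      show "AE y in lebesgue. norm (indicator (S - ball x (X n)) y *\<^sub>R f y) \<le> norm (indicator S y *\<^sub>R f y)" for n
        by (auto simp: indicator_def)
    qed
  qed
qed

lemma LIMSEQ_at_right_0:
  assumes "(f \<longlongrightarrow> L) (at_right (0 :: real))"
  shows "(\<lambda>n. f (inverse (real (Suc n)))) \<longlonglongrightarrow> L"
  by (rule filterlim_compose[OF assms])
     (use LIMSEQ_inverse_real_of_nat in \<open>auto simp: filterlim_at simp del: of_nat_Suc\<close>)

text \<open>Without cancellation a principal value is an ordinary integral: along the radii
  \<open>1 / (n + 1)\<close> the truncated integrals increase to the finite number \<open>I\<close>,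
  and monotone convergence applies. This turns exactness on a quadratic into absolute
  integrability.\<close>

lemma has_pv_integral_nonneg:
  assumes "set_borel_measurable lebesgue S f" "\<And>y. y \<in> S \<Longrightarrow> 0 \<le> f y" "has_pv_integral f I S x"
  shows "set_integrable lebesgue S f" "(LINT y:S|lebesgue. f y) = I"
proof -
  let ?f = "\<lambda>n y. indicator (S - ball x (inverse (real (Suc n)))) y *\<^sub>R f y"
  have "has_bochner_integral lebesgue (\<lambda>y. indicator S y *\<^sub>R f y) I"
  proof (rule has_bochner_integral_monotone_convergence)
    show "integrable lebesgue (?f n)" for n
      using assms(3) unfolding has_pv_integral_def set_integrable_def by auto
    have radius: "inverse (real (Suc n)) \<le> inverse (real (Suc m))" if "m \<le> n" for m n
      using that by simp
    have "indicator (S - ball x (inverse (real (Suc m)))) y * f y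
        \<le> indicator (S - ball x (inverse (real (Suc n)))) y * f y" if "m \<le> n" for m n y
      using order_less_le_trans[OF _ radius[OF that], of "dist x y"] assms(2)[of y]
      by (cases "y \<in> S") (auto simp: indicator_def simp del: of_nat_Suc)
    then show "AE y in lebesgue. mono (\<lambda>n. ?f n y)"
      by (intro AE_I2 monoI) simp
    show "AE y in lebesgue. (\<lambda>n. ?f n y) \<longlonglongrightarrow> indicator S y *\<^sub>R f y"
      using AE_lebesgue_neq[of x]
      by eventually_elim (rule indicator_minus_ball_tendsto[OF LIMSEQ_inverse_real_of_nat])
    show "(\<lambda>n. integral\<^sup>L lebesgue (?f n)) \<longlonglongrightarrow> I"
      using LIMSEQ_at_right_0[OF assms(3)[unfolded has_pv_integral_def, THEN conjunct2]]
      unfolding set_lebesgue_integral_def .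
    show "(\<lambda>y. indicator S y *\<^sub>R f y) \<in> borel_measurable lebesgue"
      using assms(1) unfolding set_borel_measurable_def .
  qed
  then show "set_integrable lebesgue S f" "(LINT y:S|lebesgue. f y) = I"
    by (auto simp: set_integrable_def set_lebesgue_integral_def has_bochner_integral_iff)
qed

section \<open>The extended domain and the kernel\<close>

lemma extended_domain_eq_Union_balls:
  assumes "0 < \<epsilon>"
  shows "extended_domain \<Omega> \<epsilon> = (\<Union>x\<in>\<Omega>. ball x \<epsilon>)"
proof -
  have "extended_domain \<Omega> \<epsilon> = \<Omega> \<union> (\<Union>x\<in>\<Omega>. ball x \<epsilon>)"
    by (auto simp: extended_domain_def interaction_domain_def dist_norm norm_minus_commute)
  moreover have "\<Omega> \<subseteq> (\<Union>x\<in>\<Omega>. ball x \<epsilon>)"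
    using assms by auto
  ultimately show ?thesis by blast
qed

lemma open_extended_domain: "0 < \<epsilon> \<Longrightarrow> open (extended_domain \<Omega> \<epsilon>)"
  by (auto simp: extended_domain_eq_Union_balls)

lemma bounded_extended_domain:
  assumes "0 < \<epsilon>" "bounded \<Omega>"
  shows "bounded (extended_domain \<Omega> \<epsilon>)"
proof -
  obtain a where a: "\<And>x. x \<in> \<Omega> \<Longrightarrow> norm x \<le> a"
    using assms(2) by (auto simp: bounded_iff)
  then have "norm y \<le> a + \<epsilon>" if "y \<in> extended_domain \<Omega> \<epsilon>" for y
  proof -
    from that have "y \<in> (\<Union>x\<in>\<Omega>. ball x \<epsilon>)"
      using assms(1) by (simp add: extended_domain_eq_Union_balls)
    then obtain x where "x \<in> \<Omega>" "norm (y - x) < \<epsilon>"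
      by (auto simp: dist_norm norm_minus_commute)
    then show ?thesis
      using a[of x] norm_triangle_sub[of y x] by simp
  qed
  then show ?thesis by (auto simp: bounded_iff)
qed

lemma polynomial_deg_le_continuous:
  assumes "polynomial_deg_le m p"
  shows "continuous_on A p"
proof -
  obtain c where p: "p = (\<lambda>x. \<Sum>k | (\<Sum>i\<in>UNIV. k i) \<le> m. c k * (\<Prod>i\<in>UNIV. (x $ i) ^ k i))"
    using assms unfolding polynomial_deg_le_def by blast
  show ?thesis
    unfolding p
    by (intro continuous_on_sum continuous_on_mult continuous_on_const continuous_on_prod
        continuous_on_power continuous_on_component continuous_on_id)
qed

lemma admissible_kernel_measurable_pair:
  assumes "admissible_kernel \<Omega> \<epsilon> \<alpha>"
  shows "(\<lambda>(x, y). \<alpha> x y) \<in> borel_measurable (lebesgue \<Otimes>\<^sub>M lebesgue)"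
  using assms unfolding admissible_kernel_def by (rule conjunct1)

lemma admissible_kernel_eq_0:
  assumes "admissible_kernel \<Omega> \<epsilon> \<alpha>" "x \<in> \<Omega>" "y \<in> extended_domain \<Omega> \<epsilon>" "\<epsilon> \<le> norm (x - y)"
  shows "ker \<alpha> x y = 0"
  using assms unfolding admissible_kernel_def by blast

lemma admissible_kernel_measurable:
  assumes "admissible_kernel \<Omega> \<epsilon> \<alpha>"
  shows "ker \<alpha> x \<in> borel_measurable lebesgue"
proof -
  have [measurable]: "\<alpha> x \<in> borel_measurable lebesgue"
    using measurable_compose[OF measurable_Pair1' admissible_kernel_measurable_pair[OF assms], of x]
    by simp
  show ?thesis unfolding ker_def[abs_def] by measurable
qed

lemma ker_nonneg [simp]: "0 \<le> ker \<alpha> x y"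
  by (simp add: ker_def)

lemma set_borel_measurable_mult_ker:
  assumes "admissible_kernel \<Omega> \<epsilon> \<alpha>" "open S" "continuous_on S f"
  shows "set_borel_measurable lebesgue S (\<lambda>y. f y * ker \<alpha> x y)"
proof -
  have [measurable]: "(\<lambda>y. indicator S y *\<^sub>R f y) \<in> borel_measurable lebesgue"
    using set_borel_measurable_lebesgue_continuous[OF assms(2,3)] by (simp add: set_borel_measurable_def)
  note admissible_kernel_measurable[OF assms(1), measurable]
  have "(\<lambda>y. (indicator S y *\<^sub>R f y) * ker \<alpha> x y) \<in> borel_measurable lebesgue"
    by measurable
  then show ?thesis by (simp add: set_borel_measurable_def mult.assoc)
qed

text \<open>The only quantitative control of the kernel in the proof. The quadratic weight
  compensates the singularity at \<open>x\<close>, where the kernel alone may fail to be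
  integrable.\<close>

lemma kernel_second_moment:
  fixes \<Omega> :: "(real ^ 'd) set" and \<epsilon> :: real
  defines "S \<equiv> extended_domain \<Omega> \<epsilon>"
  assumes "0 < \<epsilon>" "admissible_kernel \<Omega> \<epsilon> \<alpha>" "normalized_kernel \<Omega> \<epsilon> \<alpha>" "x \<in> \<Omega>"
  shows "set_integrable lebesgue S (\<lambda>y. (norm (y - x))\<^sup>2 * ker \<alpha> x y)"
    and "(LINT y:S|lebesgue. (norm (y - x))\<^sup>2 * ker \<alpha> x y) = real CARD('d)"
proof -
  let ?p = "\<lambda>y. (norm (y - x))\<^sup>2"
  have "polynomial_deg_le 3 ?p"
    by (rule polynomial_deg_le_mono[OF polynomial_deg_le_norm_power2]) simp
  then have pv: "pv_integrable (\<lambda>y. (?p y - ?p x) * ker \<alpha> x y) S x"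
    and "nonlocal_diffusion \<alpha> S ?p x = laplacian ?p x"
    using assms(4,5) unfolding normalized_kernel_def S_def by blast+
  \<comment> \<open>The Laplacian of the quadratic is \<open>2 d\<close>; its factor 2 cancels the
    one in front of the principal value in \<open>nonlocal_diffusion\<close>.\<close>
  then have "pv_integral (\<lambda>y. ?p y * ker \<alpha> x y) S x = real CARD('d)"
    by (simp add: nonlocal_diffusion_def laplacian_norm_power2)
  with has_pv_integral_pv_integral[OF pv]
  have pv: "has_pv_integral (\<lambda>y. ?p y * ker \<alpha> x y) (real CARD('d)) S x"
    by simp
  have meas: "set_borel_measurable lebesgue S (\<lambda>y. ?p y * ker \<alpha> x y)"
    unfolding S_def
    by (intro set_borel_measurable_mult_ker[OF assms(3)] open_extended_domain assms(2) continuous_intros)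
  show "set_integrable lebesgue S (\<lambda>y. ?p y * ker \<alpha> x y)"
    "(LINT y:S|lebesgue. ?p y * ker \<alpha> x y) = real CARD('d)"
    by (rule has_pv_integral_nonneg[OF meas _ pv]; simp; fail)+
qed

text \<open>Splits \<open>u\<close> into its cubic Taylor polynomial \<open>p\<close> at
  \<open>x\<close> and the remainder. The operator is exact on \<open>p\<close>; the remainder term
  is absolutely integrable and carries the whole error, with
  \<open>d^5 / 12 = 2 * d * d^4 / 24\<close>.\<close>

lemma nonlocal_diffusion_consistency:
  fixes \<Omega> :: "(real ^ 'd) set" and \<epsilon> :: real
  defines "S \<equiv> extended_domain \<Omega> \<epsilon>"
  assumes eps: "0 < \<epsilon>" and adm: "admissible_kernel \<Omega> \<epsilon> \<alpha>" and normal: "normalized_kernel \<Omega> \<epsilon> \<alpha>"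
    and x: "x \<in> \<Omega>" and u: "C_up_to_boundary 4 S u"
    and M: "\<And>js z. length js = 4 \<Longrightarrow> z \<in> S \<Longrightarrow> \<bar>partial_derivs js u z\<bar> \<le> M"
  shows "pv_integrable (\<lambda>y. (u y - u x) * ker \<alpha> x y) S x"
    and "\<bar>nonlocal_diffusion \<alpha> S u x - laplacian u x\<bar> \<le> real CARD('d) ^ 5 / 12 * \<epsilon>\<^sup>2 * M"
proof -
  define p where "p = taylor_poly 4 u x"
  \<comment> \<open>Taylor constant \<open>d^4 / 4!\<close>, with two of the four powers of
    \<open>norm (y - x)\<close> traded for \<open>\<epsilon>\<^sup>2\<close> and the other two left
    for the second moment.\<close>
  define c where "c = real CARD('d) ^ 4 / 24 * \<epsilon>\<^sup>2 * M"
  \<comment> \<open>This ball is the convex set on which Taylor's theorem is applied: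
    \<open>S\<close> itself need not be convex, but it contains the full \<epsilon>-ball about each
    point of \<Omega>.\<close>
  have ball: "ball x \<epsilon> \<subseteq> S"
    using x eps by (auto simp: S_def extended_domain_eq_Union_balls)
  have "open S"
    unfolding S_def using eps by (rule open_extended_domain)
  have "x \<in> S" using ball eps by auto
  have "0 \<le> M"
    using order_trans[OF abs_ge_zero M[of "replicate 4 undefined" x]] \<open>x \<in> S\<close> by simp
  have p3: "polynomial_deg_le 3 p"
    using polynomial_deg_le_taylor_poly[of 3 u x] by (simp add: p_def)
  have px: "p x = u x"
    using taylor_poly_centre[of 3 u x] by (simp add: p_def)
  have remainder: "\<bar>u y - p y\<bar> * ker \<alpha> x y \<le> c * ((norm (y - x))\<^sup>2 * ker \<alpha> x y)" if "y \<in> S" for y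
  proof (cases "norm (x - y) < \<epsilon>")
    case True
    have "\<bar>u y - p y\<bar> \<le> (real CARD('d) * norm (y - x)) ^ 4 * M / fact 4"
      unfolding p_def
    proof (rule taylor_poly_remainder[of "ball x \<epsilon>"])
      show "partial_derivs js u differentiable at z" if "length js < 4" "z \<in> ball x \<epsilon>" for js z
        using u that ball unfolding C_up_to_boundary_def by blast
    qed (use True M ball eps in \<open>auto simp: dist_norm\<close>)
    also have "\<dots> = real CARD('d) ^ 4 / 24 * M * ((norm (y - x))\<^sup>2 * (norm (y - x))\<^sup>2)"
      by (simp add: power_mult_distrib fact_numeral flip: power_add)
    also have "\<dots> \<le> real CARD('d) ^ 4 / 24 * M * (\<epsilon>\<^sup>2 * (norm (y - x))\<^sup>2)"
      using True \<open>0 \<le> M\<close> by (intro mult_left_mono mult_right_mono power_mono) (auto simp: norm_minus_commute)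
    finally have "\<bar>u y - p y\<bar> \<le> c * (norm (y - x))\<^sup>2"
      by (simp add: c_def mult_ac)
    from mult_right_mono[OF this, of "ker \<alpha> x y"] show ?thesis
      by (simp add: mult.assoc)
  next
    case False
    then have "ker \<alpha> x y = 0"
      using admissible_kernel_eq_0[OF adm x, of y] \<open>y \<in> S\<close> unfolding S_def by simp
    then show ?thesis by simp
  qed
  note moment = kernel_second_moment[OF eps adm normal x, folded S_def]
  let ?R = "\<lambda>y. (u y - p y) * ker \<alpha> x y"
  have dom: "set_integrable lebesgue S (\<lambda>y. c * ((norm (y - x))\<^sup>2 * ker \<alpha> x y))"
    using moment(1) by (rule set_integrable_mult_right)
  have "continuous_on S u"
    using u closure_subset[of S] unfolding C_up_to_boundary_def by (blast intro: continuous_on_subset)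
  then have "set_borel_measurable lebesgue S ?R"
    using \<open>open S\<close> polynomial_deg_le_continuous[OF p3]
    by (intro set_borel_measurable_mult_ker[OF adm] continuous_on_diff)
  then have R: "set_integrable lebesgue S ?R"
  proof (rule set_integrable_bound[OF dom], intro AE_I2 impI)
    fix y assume "y \<in> S"
    then have "norm (?R y) \<le> c * ((norm (y - x))\<^sup>2 * ker \<alpha> x y)"
      using remainder by (simp add: abs_mult)
    then show "norm (?R y) \<le> norm (c * ((norm (y - x))\<^sup>2 * ker \<alpha> x y))"
      by simp
  qed
  have "\<bar>LINT y:S|lebesgue. ?R y\<bar> \<le> (LINT y:S|lebesgue. \<bar>?R y\<bar>)"
    using set_integral_norm_bound[OF R] by simp
  also have "\<dots> \<le> (LINT y:S|lebesgue. c * ((norm (y - x))\<^sup>2 * ker \<alpha> x y))"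
    using R dom remainder by (intro set_integral_mono set_integrable_abs) (auto simp: abs_mult)
  also have "\<dots> = c * real CARD('d)"
    using moment(2) by simp
  finally have bound: "\<bar>LINT y:S|lebesgue. ?R y\<bar> \<le> c * real CARD('d)" .
  have "pv_integrable (\<lambda>y. (p y - p x) * ker \<alpha> x y) S x"
    and Lp: "nonlocal_diffusion \<alpha> S p x = laplacian p x"
    using normal x p3 unfolding normalized_kernel_def S_def by blast+
  then have "has_pv_integral (\<lambda>y. (p y - p x) * ker \<alpha> x y + ?R y)
      (pv_integral (\<lambda>y. (p y - p x) * ker \<alpha> x y) S x + (LINT y:S|lebesgue. ?R y)) S x"
    using R \<open>open S\<close>
    by (intro has_pv_integral_add has_pv_integral_pv_integral has_pv_integral_set_integrable) auto
  \<comment> \<open>Because \<open>p x = u x\<close>, the two integrands add up to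
    \<open>(u y - u x) * ker \<alpha> x y\<close>. The existence of this principal value is thus a
    conclusion, obtained from that for \<open>p\<close>.\<close>
  then have pv: "has_pv_integral (\<lambda>y. (u y - u x) * ker \<alpha> x y)
      (pv_integral (\<lambda>y. (p y - p x) * ker \<alpha> x y) S x + (LINT y:S|lebesgue. ?R y)) S x"
    by (simp add: px flip: distrib_right)
  then show "pv_integrable (\<lambda>y. (u y - u x) * ker \<alpha> x y) S x"
    unfolding pv_integrable_def by blast
  have "nonlocal_diffusion \<alpha> S u x = laplacian u x + 2 * (LINT y:S|lebesgue. ?R y)"
    using pv_integral_eq[OF pv] Lp by (simp add: nonlocal_diffusion_def p_def laplacian_taylor_poly)
  then have "\<bar>nonlocal_diffusion \<alpha> S u x - laplacian u x\<bar> \<le> 2 * (c * real CARD('d))"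
    using bound by simp
  also have "\<dots> = real CARD('d) ^ 5 / 12 * \<epsilon>\<^sup>2 * M"
    by (simp add: c_def eval_nat_numeral)
  finally show "\<bar>nonlocal_diffusion \<alpha> S u x - laplacian u x\<bar> \<le> real CARD('d) ^ 5 / 12 * \<epsilon>\<^sup>2 * M" .
qed

section \<open>The energy form\<close>

lemma integrable_mult_of_square_integrable:
  fixes f g :: "'a \<Rightarrow> real"
  assumes [measurable]: "f \<in> borel_measurable M" "g \<in> borel_measurable M"
    and "integrable M (\<lambda>x. (f x)\<^sup>2)" "integrable M (\<lambda>x. (g x)\<^sup>2)"
  shows "integrable M (\<lambda>x. f x * g x)"
proof (rule Bochner_Integration.integrable_bound[where f = "\<lambda>x. (f x)\<^sup>2 + (g x)\<^sup>2"])
  have "\<bar>a * b\<bar> \<le> a\<^sup>2 + b\<^sup>2" for a b :: real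
    using sum_squares_bound[of "\<bar>a\<bar>" "\<bar>b\<bar>"] mult_nonneg_nonneg[OF abs_ge_zero abs_ge_zero, of a b]
    unfolding abs_mult power2_abs by linarith
  then show "AE x in M. norm (f x * g x) \<le> norm ((f x)\<^sup>2 + (g x)\<^sup>2)"
    by (intro AE_I2) (simp only: real_norm_def, rule order_trans[OF _ abs_ge_self])
qed (use assms in auto)

lemma square_integrable_diff:
  fixes f g :: "'a \<Rightarrow> real"
  assumes [measurable]: "f \<in> borel_measurable M" "g \<in> borel_measurable M"
    and "integrable M (\<lambda>x. (f x)\<^sup>2)" "integrable M (\<lambda>x. (g x)\<^sup>2)"
  shows "integrable M (\<lambda>x. (f x - g x)\<^sup>2)"
  using assms integrable_mult_of_square_integrable[OF assms]
  by (simp add: power2_diff mult.assoc)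

lemma integrable_square_iff:
  fixes f :: "'a \<Rightarrow> real"
  assumes "f \<in> borel_measurable M"
  shows "integrable M (\<lambda>x. (f x)\<^sup>2) \<longleftrightarrow> (\<integral>\<^sup>+x. ennreal ((f x)\<^sup>2) \<partial>M) < \<infinity>"
  using assms by (simp add: integrable_iff_bounded)

text \<open>Cauchy-Schwarz against the indicator of \<open>A\<close>, whose L2 norm is the square
  root of the measure of \<open>A\<close>. The inequality is taken in \<open>ennreal\<close> and
  brought back to the reals, all terms being finite.\<close>

lemma set_integral_abs_le_L2:
  fixes f :: "'a \<Rightarrow> real"
  assumes [measurable]: "f \<in> borel_measurable M" "A \<in> sets M"
    and "integrable M (\<lambda>x. (f x)\<^sup>2)" "emeasure M A < \<infinity>"
  shows "set_integrable M A f"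
    and "(LINT x:A|M. \<bar>f x\<bar>) \<le> sqrt (measure M A) * sqrt (LINT x|M. (f x)\<^sup>2)"
proof -
  have "(\<lambda>x. (indicator A x :: real)\<^sup>2) = indicator A"
    by (auto simp: indicator_def)
  then have "integrable M (\<lambda>x. (indicator A x :: real)\<^sup>2)"
    using assms(2,4) by simp
  then have "integrable M (\<lambda>x. indicator A x * f x)"
    using assms by (intro integrable_mult_of_square_integrable) auto
  then show int: "set_integrable M A f"
    by (simp add: set_integrable_def)
  have abs_int: "integrable M (\<lambda>x. \<bar>f x\<bar> * indicator A x)"
    using integrable_abs[OF int[unfolded set_integrable_def]] by (simp add: abs_mult mult.commute)
  have "ennreal ((LINT x|M. \<bar>f x\<bar> * indicator A x)\<^sup>2)
      = (\<integral>\<^sup>+x. ennreal \<bar>f x\<bar> * indicator A x \<partial>M)\<^sup>2"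
    using nn_integral_eq_integral[OF abs_int]
    by (simp add: ennreal_power[symmetric] ennreal_mult ennreal_indicator)
  also have "\<dots> \<le> (\<integral>\<^sup>+x. ennreal \<bar>f x\<bar> ^ 2 \<partial>M) * (\<integral>\<^sup>+x. (indicator A x)\<^sup>2 \<partial>M)"
    by (rule Cauchy_Schwarz_nn_integral) measurable
  also have "(\<lambda>x. (indicator A x)\<^sup>2) = (indicator A :: 'a \<Rightarrow> ennreal)"
    by (auto simp: indicator_def)
  also have "(\<integral>\<^sup>+x. indicator A x \<partial>M) = emeasure M A"
    using assms(2) by simp
  also have "(\<integral>\<^sup>+x. ennreal \<bar>f x\<bar> ^ 2 \<partial>M) = ennreal (LINT x|M. (f x)\<^sup>2)"
    using nn_integral_eq_integral[OF assms(3)] by (simp add: ennreal_power)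
  also have "emeasure M A = ennreal (measure M A)"
    using assms(4) by (intro emeasure_eq_ennreal_measure) auto
  finally have "(LINT x|M. \<bar>f x\<bar> * indicator A x)\<^sup>2 \<le> (LINT x|M. (f x)\<^sup>2) * measure M A"
    by (simp flip: ennreal_mult)
  then have "\<bar>LINT x|M. \<bar>f x\<bar> * indicator A x\<bar> \<le> sqrt ((LINT x|M. (f x)\<^sup>2) * measure M A)"
    using real_sqrt_le_mono by fastforce
  then show "(LINT x:A|M. \<bar>f x\<bar>) \<le> sqrt (measure M A) * sqrt (LINT x|M. (f x)\<^sup>2)"
    by (simp add: set_lebesgue_integral_def real_sqrt_mult mult.commute)
qed

text \<open>A signed square root of the energy density, linear in \<open>v\<close>. It turns the
  energy into half a squared L2 norm on the product space and \<open>nonlocal_form\<close> into an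
  L2 inner product; the indicators absorb the restriction to \<open>S\<close>.\<close>

definition weighted_difference ::
  "(real ^ 'd \<Rightarrow> real ^ 'd \<Rightarrow> real ^ 'd) \<Rightarrow> (real ^ 'd) set \<Rightarrow> (real ^ 'd \<Rightarrow> real) \<Rightarrow>
    (real ^ 'd) \<times> (real ^ 'd) \<Rightarrow> real" where
  "weighted_difference \<alpha> S v =
    (\<lambda>(x, y). indicator S x * indicator S y * (v y - v x) * norm (\<alpha> x y))"

lemma weighted_difference_diff:
  "weighted_difference \<alpha> S (\<lambda>x. v x - w x) p = weighted_difference \<alpha> S v p - weighted_difference \<alpha> S w p"
  by (simp add: weighted_difference_def split_beta algebra_simps)

lemma weighted_difference_measurable:
  assumes \<alpha>: "(\<lambda>(x, y). \<alpha> x y) \<in> borel_measurable (lebesgue \<Otimes>\<^sub>M lebesgue)"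
    and [measurable]: "S \<in> sets lebesgue" and v: "set_borel_measurable lebesgue S v"
  shows "weighted_difference \<alpha> S v \<in> borel_measurable (lebesgue \<Otimes>\<^sub>M lebesgue)"
proof -
  \<comment> \<open>Measurability of \<open>v\<close> is given on \<open>S\<close> only, so its
    extension by zero is used; the two indicators make the replacement invisible.\<close>
  define w where "w = (\<lambda>x. indicator S x * v x)"
  have [measurable]: "w \<in> borel_measurable lebesgue"
    using v by (simp add: set_borel_measurable_def w_def)
  have [measurable]: "(\<lambda>p. norm (\<alpha> (fst p) (snd p))) \<in> borel_measurable (lebesgue \<Otimes>\<^sub>M lebesgue)"
    using measurable_compose[OF \<alpha> borel_measurable_norm] by (simp add: split_beta')
  have "(\<lambda>p. indicator S (fst p) * indicator S (snd p) * (w (snd p) - w (fst p)) * norm (\<alpha> (fst p) (snd p)))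
      \<in> borel_measurable (lebesgue \<Otimes>\<^sub>M lebesgue)"
    by measurable
  also have "(\<lambda>p. indicator S (fst p) * indicator S (snd p) * (w (snd p) - w (fst p)) * norm (\<alpha> (fst p) (snd p)))
      = weighted_difference \<alpha> S v"
    by (auto simp: weighted_difference_def w_def split_beta indicator_def)
  finally show ?thesis .
qed

text \<open>Tonelli, hence valid for infinite energy as well, so that the identity can be used to
  decide membership in \<open>V_space\<close>.\<close>

lemma energy_eq_nn_integral:
  assumes "(\<lambda>(x, y). \<alpha> x y) \<in> borel_measurable (lebesgue \<Otimes>\<^sub>M lebesgue)"
    and "S \<in> sets lebesgue" "set_borel_measurable lebesgue S v"
  shows "energy \<alpha> S v
    = (\<integral>\<^sup>+p. ennreal ((weighted_difference \<alpha> S v p)\<^sup>2) \<partial>(lebesgue \<Otimes>\<^sub>M lebesgue)) / 2"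
proof -
  note [measurable] = weighted_difference_measurable[OF assms]
  have "(\<integral>\<^sup>+y\<in>S. ennreal ((norm (nonlocal_grad \<alpha> v x y))\<^sup>2) \<partial>lebesgue) * indicator S x
      = (\<integral>\<^sup>+y. ennreal ((weighted_difference \<alpha> S v (x, y))\<^sup>2) \<partial>lebesgue)" for x
    by (cases "x \<in> S")
       (auto simp: weighted_difference_def nonlocal_grad_def power_mult_distrib indicator_def intro!: nn_integral_cong)
  moreover have "(\<integral>\<^sup>+x. (\<integral>\<^sup>+y. ennreal ((weighted_difference \<alpha> S v (x, y))\<^sup>2) \<partial>lebesgue) \<partial>lebesgue)
      = (\<integral>\<^sup>+p. ennreal ((weighted_difference \<alpha> S v p)\<^sup>2) \<partial>(lebesgue \<Otimes>\<^sub>M lebesgue))"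
    by (rule lebesgue.nn_integral_fst) measurable
  ultimately show ?thesis
    by (simp add: energy_def)
qed

lemma ennreal_half_less_top: "(x :: ennreal) / 2 < top \<longleftrightarrow> x < top"
  unfolding less_top[symmetric] ennreal_divide_eq_top_iff by simp

lemma V_spaceD:
  assumes "(\<lambda>(x, y). \<alpha> x y) \<in> borel_measurable (lebesgue \<Otimes>\<^sub>M lebesgue)"
    and "S \<in> sets lebesgue" "v \<in> V_space \<alpha> S"
  shows "weighted_difference \<alpha> S v \<in> borel_measurable (lebesgue \<Otimes>\<^sub>M lebesgue)"
    and "integrable (lebesgue \<Otimes>\<^sub>M lebesgue) (\<lambda>p. (weighted_difference \<alpha> S v p)\<^sup>2)"
    and "(\<lambda>x. indicator S x * v x) \<in> borel_measurable lebesgue"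
    and "integrable lebesgue (\<lambda>x. (indicator S x * v x)\<^sup>2)"
proof -
  have v: "set_borel_measurable lebesgue S v" "energy \<alpha> S v < \<infinity>"
    and fin: "(\<integral>\<^sup>+x\<in>S. ennreal ((v x)\<^sup>2) \<partial>lebesgue) < \<infinity>"
    using assms(3) by (auto simp: V_space_def L2_on_def)
  show meas: "weighted_difference \<alpha> S v \<in> borel_measurable (lebesgue \<Otimes>\<^sub>M lebesgue)"
    using assms(1,2) v(1) by (rule weighted_difference_measurable)
  show "integrable (lebesgue \<Otimes>\<^sub>M lebesgue) (\<lambda>p. (weighted_difference \<alpha> S v p)\<^sup>2)"
    using v(2) unfolding integrable_square_iff[OF meas] energy_eq_nn_integral[OF assms(1,2) v(1)]
    by (simp add: ennreal_half_less_top)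
  show meas': "(\<lambda>x. indicator S x * v x) \<in> borel_measurable lebesgue"
    using v(1) by (simp add: set_borel_measurable_def)
  have "(\<integral>\<^sup>+x\<in>S. ennreal ((v x)\<^sup>2) \<partial>lebesgue) = (\<integral>\<^sup>+x. ennreal ((indicator S x * v x)\<^sup>2) \<partial>lebesgue)"
    by (intro nn_integral_cong) (simp add: indicator_def)
  then show "integrable lebesgue (\<lambda>x. (indicator S x * v x)\<^sup>2)"
    using fin unfolding integrable_square_iff[OF meas'] by simp
qed

lemma V_space_diff:
  assumes "(\<lambda>(x, y). \<alpha> x y) \<in> borel_measurable (lebesgue \<Otimes>\<^sub>M lebesgue)"
    and "S \<in> sets lebesgue" "v \<in> V_space \<alpha> S" "w \<in> V_space \<alpha> S"
  shows "(\<lambda>x. v x - w x) \<in> V_space \<alpha> S"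
proof -
  note v = V_spaceD[OF assms(1-3)] and w = V_spaceD[OF assms(1,2,4)]
  have meas: "set_borel_measurable lebesgue S (\<lambda>x. v x - w x)"
    using borel_measurable_diff[OF v(3) w(3)] by (simp add: set_borel_measurable_def algebra_simps)
  have sq: "integrable lebesgue (\<lambda>x. (indicator S x * (v x - w x))\<^sup>2)"
    using square_integrable_diff[OF v(3) w(3) v(4) w(4)] by (simp add: algebra_simps)
  have "(\<integral>\<^sup>+x\<in>S. ennreal ((v x - w x)\<^sup>2) \<partial>lebesgue)
      = (\<integral>\<^sup>+x. ennreal ((indicator S x * (v x - w x))\<^sup>2) \<partial>lebesgue)"
    by (intro nn_integral_cong) (simp add: indicator_def)
  also have "\<dots> < \<infinity>"
    using sq meas by (subst integrable_square_iff[symmetric]) (auto simp: set_borel_measurable_def)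
  finally have "L2_on lebesgue S (\<lambda>x. v x - w x)"
    using meas by (simp add: L2_on_def)
  moreover have "energy \<alpha> S (\<lambda>x. v x - w x) < \<infinity>"
    using square_integrable_diff[OF v(1) w(1) v(2) w(2)]
      integrable_square_iff[OF weighted_difference_measurable[OF assms(1,2) meas]]
    unfolding energy_eq_nn_integral[OF assms(1,2) meas]
    by (simp add: weighted_difference_diff ennreal_half_less_top)
  ultimately show ?thesis by (simp add: V_space_def)
qed

lemma energy_norm_power2:
  assumes "(\<lambda>(x, y). \<alpha> x y) \<in> borel_measurable (lebesgue \<Otimes>\<^sub>M lebesgue)"
    and "S \<in> sets lebesgue" "v \<in> V_space \<alpha> S"
  shows "2 * (energy_norm \<alpha> S v)\<^sup>2
    = (LINT p|(lebesgue \<Otimes>\<^sub>M lebesgue). (weighted_difference \<alpha> S v p)\<^sup>2)"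
proof -
  have "set_borel_measurable lebesgue S v"
    using assms(3) by (auto simp: V_space_def L2_on_def)
  then have "energy \<alpha> S v
      = ennreal (LINT p|(lebesgue \<Otimes>\<^sub>M lebesgue). (weighted_difference \<alpha> S v p)\<^sup>2) / 2"
    using nn_integral_eq_integral[OF V_spaceD(2)[OF assms]]
    by (simp add: energy_eq_nn_integral[OF assms(1,2)])
  moreover have "ennreal t / 2 = ennreal (t / 2)" if "0 \<le> t" for t
    using divide_ennreal[OF that, of 2] by simp
  ultimately show ?thesis
    by (simp add: energy_norm_def)
qed

text \<open>A product of two L2 functions is integrable, which is what permits Fubini. The resulting
  single integral makes linearity of the form immediate; the sign changes in the two differences
  cancel.\<close>

lemma nonlocal_form_eq_integral:
  assumes "(\<lambda>(x, y). \<alpha> x y) \<in> borel_measurable (lebesgue \<Otimes>\<^sub>M lebesgue)"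
    and "S \<in> sets lebesgue" "v \<in> V_space \<alpha> S" "w \<in> V_space \<alpha> S"
  shows "integrable (lebesgue \<Otimes>\<^sub>M lebesgue) (\<lambda>p. weighted_difference \<alpha> S v p * weighted_difference \<alpha> S w p)"
    and "nonlocal_form \<alpha> S v w
      = (LINT p|(lebesgue \<Otimes>\<^sub>M lebesgue). weighted_difference \<alpha> S v p * weighted_difference \<alpha> S w p)"
proof -
  note v = V_spaceD[OF assms(1-3)] and w = V_spaceD[OF assms(1,2,4)]
  show int: "integrable (lebesgue \<Otimes>\<^sub>M lebesgue) (\<lambda>p. weighted_difference \<alpha> S v p * weighted_difference \<alpha> S w p)"
    using v(1) w(1) v(2) w(2) by (rule integrable_mult_of_square_integrable)
  have "indicator S x *\<^sub>R (LINT y:S|lebesgue. (v x - v y) * (w x - w y) * ker \<alpha> x y)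
      = (LINT y|lebesgue. weighted_difference \<alpha> S v (x, y) * weighted_difference \<alpha> S w (x, y))" for x
  proof (cases "x \<in> S")
    case True
    have "indicator S y *\<^sub>R ((v x - v y) * (w x - w y) * ker \<alpha> x y)
        = weighted_difference \<alpha> S v (x, y) * weighted_difference \<alpha> S w (x, y)" for y
      using True
      by (simp add: weighted_difference_def ker_def indicator_def power2_norm_eq_inner[symmetric]
          power2_eq_square algebra_simps)
    with True show ?thesis by (simp add: set_lebesgue_integral_def)
  qed (simp add: weighted_difference_def)
  then show "nonlocal_form \<alpha> S v w
      = (LINT p|(lebesgue \<Otimes>\<^sub>M lebesgue). weighted_difference \<alpha> S v p * weighted_difference \<alpha> S w p)"
    using lebesgue_pair.integral_fst'[OF int]
    by (simp add: nonlocal_form_def set_lebesgue_integral_def[of lebesgue S "\<lambda>x. LINT y:S|lebesgue. _ x y"])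
qed

lemma nonlocal_form_diff_left:
  assumes "(\<lambda>(x, y). \<alpha> x y) \<in> borel_measurable (lebesgue \<Otimes>\<^sub>M lebesgue)"
    and "S \<in> sets lebesgue" "v \<in> V_space \<alpha> S" "w \<in> V_space \<alpha> S" "z \<in> V_space \<alpha> S"
  shows "nonlocal_form \<alpha> S (\<lambda>x. v x - w x) z = nonlocal_form \<alpha> S v z - nonlocal_form \<alpha> S w z"
  using nonlocal_form_eq_integral[OF assms(1-3,5)] nonlocal_form_eq_integral[OF assms(1,2,4,5)]
    nonlocal_form_eq_integral[OF assms(1,2) V_space_diff[OF assms(1-4)] assms(5)]
  by (simp add: weighted_difference_diff left_diff_distrib)

lemma nonlocal_form_self:
  assumes "(\<lambda>(x, y). \<alpha> x y) \<in> borel_measurable (lebesgue \<Otimes>\<^sub>M lebesgue)"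
    and "S \<in> sets lebesgue" "v \<in> V_space \<alpha> S"
  shows "nonlocal_form \<alpha> S v v = 2 * (energy_norm \<alpha> S v)\<^sup>2"
  using nonlocal_form_eq_integral(2)[OF assms assms(3)] energy_norm_power2[OF assms]
  by (simp add: power2_eq_square)

text \<open>A principal value is the limit along the radii \<open>1 / (n + 1)\<close> of truncated
  integrals, and each of these depends measurably on \<open>x\<close> because its integrand is
  jointly measurable.\<close>

lemma nonlocal_diffusion_measurable:
  assumes \<alpha>: "(\<lambda>(x, y). \<alpha> x y) \<in> borel_measurable (lebesgue \<Otimes>\<^sub>M lebesgue)"
    and [measurable]: "S \<in> sets lebesgue" "A \<in> sets lebesgue"
    and "A \<subseteq> S" and v: "set_borel_measurable lebesgue S v"
    and pv: "\<And>x. x \<in> A \<Longrightarrow> pv_integrable (\<lambda>y. (v y - v x) * ker \<alpha> x y) S x"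
  shows "set_borel_measurable lebesgue A (nonlocal_diffusion \<alpha> S v)"
proof -
  define w where "w = (\<lambda>x. indicator S x * v x)"
  define F where "F = (\<lambda>r x. LINT y|lebesgue.
      (if dist x y < r then 0 else indicator S y * (w y - w x) * ker \<alpha> x y))"
  have [measurable]: "w \<in> borel_measurable lebesgue"
    using v by (simp add: set_borel_measurable_def w_def)
  have [measurable]: "(\<lambda>p. ker \<alpha> (fst p) (snd p)) \<in> borel_measurable (lebesgue \<Otimes>\<^sub>M lebesgue)"
    using borel_measurable_inner[OF \<alpha> \<alpha>] by (simp add: ker_def split_beta')
  have id: "(\<lambda>x. x) \<in> borel_measurable (lebesgue :: (real ^ 'a) measure)"
    by (rule measurable_completion) simp
  have [measurable]: "(\<lambda>p. dist (fst p) (snd p)) \<in> borel_measurable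
      (lebesgue \<Otimes>\<^sub>M lebesgue :: ((real ^ 'a) \<times> (real ^ 'a)) measure)"
    using measurable_compose[OF measurable_fst id] measurable_compose[OF measurable_snd id]
    by (rule borel_measurable_dist)
  have "(\<lambda>p. if dist (fst p) (snd p) < r then 0
      else indicator S (snd p) * (w (snd p) - w (fst p)) * ker \<alpha> (fst p) (snd p))
      \<in> borel_measurable (lebesgue \<Otimes>\<^sub>M lebesgue)" for r
    by measurable
  then have [measurable]: "F r \<in> borel_measurable lebesgue" for r
    unfolding F_def by (intro lebesgue.borel_measurable_lebesgue_integral) (simp add: split_beta')
  have lim: "(\<lambda>n. 2 * (indicator A x * F (inverse (real (Suc n))) x))
      \<longlonglongrightarrow> indicator A x *\<^sub>R nonlocal_diffusion \<alpha> S v x" for x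
  proof (cases "x \<in> A")
    case True
    then have "x \<in> S" using \<open>A \<subseteq> S\<close> by auto
    then have "F r x = (LINT y:S - ball x r|lebesgue. (v y - v x) * ker \<alpha> x y)" for r
      unfolding F_def set_lebesgue_integral_def
      by (intro Bochner_Integration.integral_cong) (auto simp: w_def indicator_def)
    then have "(\<lambda>n. F (inverse (real (Suc n))) x)
        \<longlonglongrightarrow> pv_integral (\<lambda>y. (v y - v x) * ker \<alpha> x y) S x"
      using LIMSEQ_at_right_0[OF has_pv_integral_pv_integral[OF pv[OF True],
            unfolded has_pv_integral_def, THEN conjunct2]]
      by simp
    then show ?thesis
      using True by (simp add: nonlocal_diffusion_def tendsto_mult_left)
  qed simp
  show ?thesis
    unfolding set_borel_measurable_def
    by (rule borel_measurable_LIMSEQ_real[OF lim]) measurable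
qed

text \<open>A real \<open>Sup\<close> bounds its elements only if the set is bounded above. It is:
  every fourth derivative extends continuously to the compact closure of \<open>S\<close>, and there
  are finitely many index lists of length 4.\<close>

lemma partial_derivs_le_D4_sup_norm:
  assumes "bounded S" "C_up_to_boundary 4 S u" "length js = 4" "x \<in> S"
  shows "\<bar>partial_derivs js u x\<bar> \<le> D4_sup_norm S u"
proof -
  have "\<exists>B. \<forall>x\<in>S. \<bar>partial_derivs ks u x\<bar> \<le> B" if ks: "length ks = 4" for ks
  proof -
    obtain g where g: "continuous_on (closure S) g" "\<forall>x\<in>S. g x = partial_derivs ks u x"
      using assms(2) ks unfolding C_up_to_boundary_def by (metis order_refl)
    have "compact (g ` closure S)"
      using g(1) assms(1) by (intro compact_continuous_image) auto
    then obtain B where "\<forall>y\<in>g ` closure S. norm y \<le> B"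
      using compact_imp_bounded bounded_iff by blast
    then have "\<forall>x\<in>S. \<bar>g x\<bar> \<le> B"
      using closure_subset[of S] by auto
    then show ?thesis
      using g(2) by auto
  qed
  then obtain B where B: "\<And>ks x. length ks = 4 \<Longrightarrow> x \<in> S \<Longrightarrow> \<bar>partial_derivs ks u x\<bar> \<le> B ks"
    by metis
  have fin: "finite {ks :: 'a list. length ks = 4}"
    using finite_lists_length_eq[of "UNIV :: 'a set" 4] by simp
  have "bdd_above (insert 0 {\<bar>partial_derivs ks u x\<bar> | ks x. length ks = 4 \<and> x \<in> S})"
  proof (rule bdd_aboveI[of _ "\<Sum>ks | length ks = 4. \<bar>B ks\<bar>"])
    fix t assume t: "t \<in> insert 0 {\<bar>partial_derivs ks u x\<bar> | ks x. length ks = 4 \<and> x \<in> S}"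
    show "t \<le> (\<Sum>ks | length ks = 4. \<bar>B ks\<bar>)"
    proof (cases "t = 0")
      case False
      then obtain ks x where ks: "t = \<bar>partial_derivs ks u x\<bar>" "length ks = 4" "x \<in> S"
        using t by blast
      have "t \<le> \<bar>B ks\<bar>"
        using B[OF ks(2,3)] ks(1) by simp
      also have "\<dots> \<le> (\<Sum>ks | length ks = 4. \<bar>B ks\<bar>)"
        using fin ks(2) by (intro member_le_sum) auto
      finally show ?thesis .
    qed (simp add: sum_nonneg)
  qed
  then show ?thesis
    unfolding D4_sup_norm_def using assms(3,4) by (intro cSup_upper) blast+
qed

section \<open>The error estimate\<close>

lemma D4_sup_norm_nonneg:
  assumes "bounded S" "C_up_to_boundary 4 S u"
  shows "0 \<le> D4_sup_norm S u"
proof (cases "S = {}")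
  case True
  then show ?thesis by (simp add: D4_sup_norm_def)
next
  case False
  then obtain z where "z \<in> S" by blast
  then show ?thesis
    using order_trans[OF abs_ge_zero partial_derivs_le_D4_sup_norm[OF assms, of "replicate 4 undefined" z]]
    by simp
qed

text \<open>The estimate at a fixed horizon. Apart from \<open>\<epsilon>\<^sup>2\<close> and the
  norm of \<open>ul\<close>, the bound contains only \<open>Cpn\<close>, the volume of \<Omega> (not
  of the extended domain) and the dimension, so one constant serves all horizons.\<close>

lemma nonlocal_error_estimate:
  fixes \<Omega> :: "(real ^ 'd) set" and \<epsilon> Cpn :: real
  defines "S \<equiv> extended_domain \<Omega> \<epsilon>"
  assumes eps: "0 < \<epsilon>" and \<Omega>: "bounded \<Omega>" "open \<Omega>"
    and adm: "admissible_kernel \<Omega> \<epsilon> \<alpha>" and normal: "normalized_kernel \<Omega> \<epsilon> \<alpha>"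
    and poincare: "\<And>v. v \<in> Vc_space \<alpha> S \<Omega>D \<Longrightarrow> L2_norm S v \<le> Cpn * energy_norm \<alpha> S v"
    and green: "green_identity \<alpha> \<Omega> S \<Omega>D P"
    and s: "in_dual \<alpha> S \<Omega>D s" "AE x in lebesgue. x \<in> S \<longrightarrow> - laplacian ul x = s x"
    and ul: "C_up_to_boundary 4 S ul" "ul \<in> V_space \<alpha> S" "AE x in lebesgue. x \<in> \<Omega>D \<longrightarrow> ul x = vn x"
    and un: "nonlocal_weak_solution \<alpha> \<Omega> S \<Omega>D s (\<lambda>z. - P ul z) vn un"
  shows "(\<lambda>x. un x - ul x) \<in> Vc_space \<alpha> S \<Omega>D"
    and "Cpn * energy_norm \<alpha> S (\<lambda>x. un x - ul x)
      \<le> Cpn\<^sup>2 * sqrt (measure lebesgue \<Omega>) * real CARD('d) ^ 5 / 24 * \<epsilon>\<^sup>2 * D4_sup_norm S ul"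
proof -
  define e where "e = (\<lambda>x. un x - ul x)"
  define M where "M = D4_sup_norm S ul"
  define \<kappa> where "\<kappa> = real CARD('d) ^ 5 / 12 * \<epsilon>\<^sup>2 * M"
  define E where "E = energy_norm \<alpha> S e"
  have "open S" "bounded S"
    unfolding S_def using eps \<Omega> by (auto intro: open_extended_domain bounded_extended_domain)
  then have S: "S \<in> sets lebesgue" by simp
  have \<Omega>S: "\<Omega> \<subseteq> S" by (auto simp: S_def extended_domain_def)
  have \<Omega>_sets: "\<Omega> \<in> sets lebesgue" using \<Omega>(2) by simp
  have fin: "emeasure lebesgue \<Omega> < \<infinity>"
    using emeasure_bounded_finite[OF \<Omega>(1)] \<Omega>(2) by simp
  note \<alpha> = admissible_kernel_measurable_pair[OF adm]
  have un_V: "un \<in> V_space \<alpha> S" and un_D: "AE x in lebesgue. x \<in> \<Omega>D \<longrightarrow> un x = vn x"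
    and weak: "\<And>z. z \<in> Vc_space \<alpha> S \<Omega>D \<Longrightarrow>
      nonlocal_form \<alpha> S un z = - P ul z + (LINT x:\<Omega>|lebesgue. s x * z x)"
    using un unfolding nonlocal_weak_solution_def by auto
  have eV: "e \<in> V_space \<alpha> S"
    unfolding e_def using \<alpha> S un_V ul(2) by (rule V_space_diff)
  moreover have "AE x in lebesgue. x \<in> \<Omega>D \<longrightarrow> e x = 0"
    using un_D ul(3) by eventually_elim (simp add: e_def)
  ultimately have eVc: "e \<in> Vc_space \<alpha> S \<Omega>D"
    by (simp add: Vc_space_def)
  then show "(\<lambda>x. un x - ul x) \<in> Vc_space \<alpha> S \<Omega>D" by (simp add: e_def)

  have bound: "\<bar>partial_derivs js ul z\<bar> \<le> M" if "length js = 4" "z \<in> S" for js z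
    unfolding M_def using \<open>bounded S\<close> ul(1) that by (rule partial_derivs_le_D4_sup_norm)
  note consistency = nonlocal_diffusion_consistency[OF eps adm normal, folded S_def, OF _ ul(1) bound, folded \<kappa>_def]
  have "0 \<le> M"
    unfolding M_def using \<open>bounded S\<close> ul(1) by (rule D4_sup_norm_nonneg)
  then have "0 \<le> \<kappa>" by (simp add: \<kappa>_def)

  \<comment> \<open>The consistency error: as \<open>s\<close> equals minus the Laplacian of
    \<open>ul\<close> almost everywhere, this is the nonlocal minus the local operator applied to
    \<open>ul\<close>.\<close>
  let ?d = "\<lambda>x. s x + nonlocal_diffusion \<alpha> S ul x"
  have "set_borel_measurable lebesgue S ul"
    using ul(2) by (simp add: V_space_def L2_on_def)
  then have "set_borel_measurable lebesgue \<Omega> (nonlocal_diffusion \<alpha> S ul)"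
    by (rule nonlocal_diffusion_measurable[OF \<alpha> S \<Omega>_sets \<Omega>S]) (rule consistency(1))
  moreover have "set_borel_measurable lebesgue \<Omega> s"
    using s(1) \<Omega>S \<Omega>_sets by (auto simp: in_dual_def intro: set_borel_measurable_subset)
  ultimately have d_meas: "(\<lambda>x. indicator \<Omega> x * ?d x) \<in> borel_measurable lebesgue"
    using borel_measurable_add unfolding set_borel_measurable_def by (fastforce simp: distrib_left)
  have d_bound: "AE x in lebesgue. x \<in> \<Omega> \<longrightarrow> \<bar>?d x\<bar> \<le> \<kappa>"
    using s(2)
  proof eventually_elim
    case (elim x)
    then show ?case
      using consistency(2)[of x] \<Omega>S by (auto simp: algebra_simps)
  qed

  \<comment> \<open>Extension of the error by zero, measurable and square-integrable on the whole
    space, whereas \<open>e\<close> is controlled on \<open>S\<close> only.\<close>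
  define f where "f = (\<lambda>x. indicator S x * e x)"
  have f_meas: "f \<in> borel_measurable lebesgue" and f_sq: "integrable lebesgue (\<lambda>x. (f x)\<^sup>2)"
    unfolding f_def using V_spaceD[OF \<alpha> S eV] by auto
  note f_int = set_integral_abs_le_L2[OF f_meas \<Omega>_sets f_sq fin]
  have f_e: "f x = e x" if "x \<in> \<Omega>" for x
    using that \<Omega>S by (auto simp: f_def)
  have de_bound: "AE x in lebesgue. x \<in> \<Omega> \<longrightarrow> \<bar>?d x * e x\<bar> \<le> \<kappa> * \<bar>f x\<bar>"
    using d_bound by eventually_elim (auto simp: f_e abs_mult intro: mult_right_mono)
  have \<kappa>f: "set_integrable lebesgue \<Omega> (\<lambda>x. \<kappa> * \<bar>f x\<bar>)"
    by (intro set_integrable_mult_right set_integrable_abs f_int(1))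
  have "(\<lambda>x. (indicator \<Omega> x * ?d x) * f x) \<in> borel_measurable lebesgue"
    using d_meas f_meas by (rule borel_measurable_times)
  also have "(\<lambda>x. (indicator \<Omega> x * ?d x) * f x) = (\<lambda>x. indicator \<Omega> x *\<^sub>R (?d x * e x))"
    by (auto simp: indicator_def f_e)
  finally have de_meas: "set_borel_measurable lebesgue \<Omega> (\<lambda>x. ?d x * e x)"
    by (simp add: set_borel_measurable_def)
  have de: "set_integrable lebesgue \<Omega> (\<lambda>x. ?d x * e x)"
  proof (rule set_integrable_bound[OF \<kappa>f de_meas])
    show "AE x\<in>\<Omega> in lebesgue. norm (?d x * e x) \<le> norm (\<kappa> * \<bar>f x\<bar>)"
      using de_bound by eventually_elim (auto intro: order_trans[OF _ abs_ge_self])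
  qed
  have se: "set_integrable lebesgue \<Omega> (\<lambda>x. s x * e x)"
    using s(1) eVc \<Omega>S \<Omega>_sets by (auto simp: in_dual_def intro: set_integrable_subset)
  \<comment> \<open>Integrability of the diffusion term against \<open>e\<close> is inherited from
    the two integrals on the right.\<close>
  have Le: "(LINT x:\<Omega>|lebesgue. nonlocal_diffusion \<alpha> S ul x * e x)
      = (LINT x:\<Omega>|lebesgue. ?d x * e x) - (LINT x:\<Omega>|lebesgue. s x * e x)"
    using set_integral_diff(2)[OF de se] by (simp add: algebra_simps)

  have "2 * E\<^sup>2 = nonlocal_form \<alpha> S un e - nonlocal_form \<alpha> S ul e"
    unfolding E_def nonlocal_form_self[OF \<alpha> S eV, symmetric]
    by (rule nonlocal_form_diff_left[OF \<alpha> S un_V ul(2) eV, folded e_def])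
  \<comment> \<open>Both the weak equation and Green's identity contain \<open>- P ul e\<close>,
    since the nonlocal Neumann datum is the flux of \<open>ul\<close> itself; subtraction removes
    it.\<close>
  also have "\<dots> = (LINT x:\<Omega>|lebesgue. s x * e x) + (LINT x:\<Omega>|lebesgue. nonlocal_diffusion \<alpha> S ul x * e x)"
    using weak[OF eVc] green ul(1) eVc by (simp add: green_identity_def)
  also have "\<dots> = (LINT x:\<Omega>|lebesgue. ?d x * e x)"
    by (simp add: Le)
  also have "\<dots> \<le> (LINT x:\<Omega>|lebesgue. \<kappa> * \<bar>f x\<bar>)"
    using de_bound by (intro set_integral_mono_AE[OF de \<kappa>f]) auto
  also have "\<dots> \<le> \<kappa> * (sqrt (measure lebesgue \<Omega>) * sqrt (LINT x|lebesgue. (f x)\<^sup>2))"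
    using f_int(2) \<open>0 \<le> \<kappa>\<close> by (simp add: mult_left_mono)
  also have "(LINT x|lebesgue. (f x)\<^sup>2) = (LINT x:S|lebesgue. (e x)\<^sup>2)"
    unfolding set_lebesgue_integral_def f_def
    by (intro Bochner_Integration.integral_cong) (auto simp: indicator_def)
  also have "sqrt \<dots> = L2_norm S e"
    by (simp add: L2_norm_def)
  also have "\<kappa> * (sqrt (measure lebesgue \<Omega>) * L2_norm S e)
      \<le> \<kappa> * (sqrt (measure lebesgue \<Omega>) * (Cpn * E))"
    unfolding E_def using poincare[OF eVc] \<open>0 \<le> \<kappa>\<close> by (intro mult_left_mono) auto
  finally have energy: "2 * E * E \<le> (\<kappa> * sqrt (measure lebesgue \<Omega>) * Cpn) * E"
    by (simp add: power2_eq_square mult_ac)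
  have "0 \<le> E" by (simp add: E_def energy_norm_def)
  have "Cpn * E \<le> Cpn\<^sup>2 * sqrt (measure lebesgue \<Omega>) * \<kappa> / 2"
  \<comment> \<open>One factor \<open>E\<close> is cancelled from \<open>energy\<close>, which
    requires \<open>E > 0\<close>. The sign of \<open>Cpn\<close> is not prescribed, so the
    remaining cases are settled by \<open>Cpn * E \<le> 0\<close>.\<close>
  proof (cases "E > 0 \<and> Cpn > 0")
    case True
    then have "2 * E \<le> \<kappa> * sqrt (measure lebesgue \<Omega>) * Cpn"
      using energy by simp
    from mult_left_mono[OF this, of Cpn] True show ?thesis
      by (simp add: power2_eq_square mult_ac)
  next
    case False
    then have "Cpn * E \<le> 0"
      using \<open>0 \<le> E\<close> by (auto simp: mult_le_0_iff)
    also have "0 \<le> Cpn\<^sup>2 * sqrt (measure lebesgue \<Omega>) * \<kappa> / 2"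
      using \<open>0 \<le> \<kappa>\<close> by simp
    finally show ?thesis .
  qed
  then show "Cpn * energy_norm \<alpha> S (\<lambda>x. un x - ul x)
      \<le> Cpn\<^sup>2 * sqrt (measure lebesgue \<Omega>) * real CARD('d) ^ 5 / 24 * \<epsilon>\<^sup>2 * D4_sup_norm S ul"
    by (simp add: E_def e_def \<kappa>_def M_def mult_ac)
qed

theorem mainTheorem2:
  fixes \<Omega> :: "(real ^ 'd) set"
    and \<epsilon>0 Cpn :: real
    and \<alpha> :: "real \<Rightarrow> real ^ 'd \<Rightarrow> real ^ 'd \<Rightarrow> real ^ 'd"
    and \<Omega>N \<Omega>D \<Gamma>N \<Gamma>D :: "real \<Rightarrow> (real ^ 'd) set"
    and \<nu> :: "real \<Rightarrow> real ^ 'd \<Rightarrow> real ^ 'd"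
    and P :: "real \<Rightarrow> (real ^ 'd \<Rightarrow> real) \<Rightarrow> (real ^ 'd \<Rightarrow> real) \<Rightarrow> real"
  assumes dim: "CARD('d) \<in> {1, 2, 3}"
    and eps0: "0 < \<epsilon>0"
    and domain: "bounded \<Omega>" "open \<Omega>" "lipschitz_boundary \<Omega>"
    and decomposition: "\<And>\<epsilon>. \<epsilon> \<in> {0<..\<epsilon>0} \<Longrightarrow>
          domain_decomposition \<Omega> \<epsilon> (\<Omega>N \<epsilon>) (\<Omega>D \<epsilon>) (\<Gamma>N \<epsilon>) (\<Gamma>D \<epsilon>)"
    and normal: "\<And>\<epsilon>. \<epsilon> \<in> {0<..\<epsilon>0} \<Longrightarrow>
          AE p in surface_measure. p \<in> frontier (extended_domain \<Omega> \<epsilon>) \<longrightarrow>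
            outer_unit_normal (extended_domain \<Omega> \<epsilon>) p (\<nu> \<epsilon> p)"
    and kernel: "\<And>\<epsilon>. \<epsilon> \<in> {0<..\<epsilon>0} \<Longrightarrow> admissible_kernel \<Omega> \<epsilon> (\<alpha> \<epsilon>)"
    and normalization: "\<And>\<epsilon>. \<epsilon> \<in> {0<..\<epsilon>0} \<Longrightarrow> normalized_kernel \<Omega> \<epsilon> (\<alpha> \<epsilon>)"
    and local_limit: "\<And>w x. C_up_to_boundary 4 (extended_domain \<Omega> \<epsilon>0) w \<Longrightarrow> x \<in> \<Omega> \<Longrightarrow>
          ((\<lambda>\<epsilon>. nonlocal_diffusion (\<alpha> \<epsilon>) (extended_domain \<Omega> \<epsilon>) w x) \<longlongrightarrow> laplacian w x) (at_right 0)"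
    and smooth_in_V: "\<And>\<epsilon> w. \<epsilon> \<in> {0<..\<epsilon>0} \<Longrightarrow> C_up_to_boundary 4 (extended_domain \<Omega> \<epsilon>) w \<Longrightarrow>
          w \<in> V_space (\<alpha> \<epsilon>) (extended_domain \<Omega> \<epsilon>)"
    and poincare: "\<And>\<epsilon> v. \<epsilon> \<in> {0<..\<epsilon>0} \<Longrightarrow>
          v \<in> Vc_space (\<alpha> \<epsilon>) (extended_domain \<Omega> \<epsilon>) (\<Omega>D \<epsilon>) \<Longrightarrow>
          L2_norm (extended_domain \<Omega> \<epsilon>) v \<le> Cpn * energy_norm (\<alpha> \<epsilon>) (extended_domain \<Omega> \<epsilon>) v"
    and pairing: "\<And>\<epsilon>. \<epsilon> \<in> {0<..\<epsilon>0} \<Longrightarrow>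
          neumann_pairing (\<alpha> \<epsilon>) (extended_domain \<Omega> \<epsilon>) (\<Omega>N \<epsilon>) (\<Omega>D \<epsilon>) (P \<epsilon>)"
    and green: "\<And>\<epsilon>. \<epsilon> \<in> {0<..\<epsilon>0} \<Longrightarrow>
          green_identity (\<alpha> \<epsilon>) \<Omega> (extended_domain \<Omega> \<epsilon>) (\<Omega>D \<epsilon>) (P \<epsilon>)"
  shows "\<exists>Chat > 0. \<forall>\<epsilon> \<in> {0<..\<epsilon>0}. \<forall>s gl vn tr ul un.
           in_dual (\<alpha> \<epsilon>) (extended_domain \<Omega> \<epsilon>) (\<Omega>D \<epsilon>) s \<longrightarrow>
           L2_on surface_measure (\<Gamma>N \<epsilon>) gl \<longrightarrow>
           dirichlet_datum (\<alpha> \<epsilon>) (extended_domain \<Omega> \<epsilon>) (\<Omega>D \<epsilon>) (\<Gamma>D \<epsilon>) vn tr \<longrightarrow>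
           local_solution (extended_domain \<Omega> \<epsilon>) (\<Gamma>N \<epsilon>) (\<Gamma>D \<epsilon>) (\<nu> \<epsilon>) s gl tr ul \<longrightarrow>
           (AE x in lebesgue. x \<in> \<Omega>D \<epsilon> \<longrightarrow> ul x = vn x) \<longrightarrow>
           nonlocal_weak_solution (\<alpha> \<epsilon>) \<Omega> (extended_domain \<Omega> \<epsilon>) (\<Omega>D \<epsilon>) s
             (\<lambda>z. - P \<epsilon> ul z) vn un \<longrightarrow>
           L2_norm (extended_domain \<Omega> \<epsilon>) (\<lambda>x. un x - ul x)
             \<le> Cpn * energy_norm (\<alpha> \<epsilon>) (extended_domain \<Omega> \<epsilon>) (\<lambda>x. un x - ul x) \<and>
           Cpn * energy_norm (\<alpha> \<epsilon>) (extended_domain \<Omega> \<epsilon>) (\<lambda>x. un x - ul x)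
             \<le> Chat * \<epsilon>\<^sup>2 * D4_sup_norm (extended_domain \<Omega> \<epsilon>) ul"
proof -
  define C where "C = Cpn\<^sup>2 * sqrt (measure lebesgue \<Omega>) * real CARD('d) ^ 5 / 24"
  have "0 \<le> C" by (simp add: C_def)
  show ?thesis
  \<comment> \<open>\<open>C\<close> vanishes when \<open>Cpn = 0\<close> or \<Omega> is empty;
    adding 1 yields a strictly positive constant.\<close>
  proof (intro exI[of _ "C + 1"] conjI ballI allI impI)
    show "0 < C + 1" using \<open>0 \<le> C\<close> by simp
  next
    fix \<epsilon> s gl vn tr ul un
    assume \<epsilon>: "\<epsilon> \<in> {0<..\<epsilon>0}"
      and s: "in_dual (\<alpha> \<epsilon>) (extended_domain \<Omega> \<epsilon>) (\<Omega>D \<epsilon>) s"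
      and ul: "local_solution (extended_domain \<Omega> \<epsilon>) (\<Gamma>N \<epsilon>) (\<Gamma>D \<epsilon>) (\<nu> \<epsilon>) s gl tr ul"
      and vn: "AE x in lebesgue. x \<in> \<Omega>D \<epsilon> \<longrightarrow> ul x = vn x"
      and un: "nonlocal_weak_solution (\<alpha> \<epsilon>) \<Omega> (extended_domain \<Omega> \<epsilon>) (\<Omega>D \<epsilon>) s
        (\<lambda>z. - P \<epsilon> ul z) vn un"
    let ?S = "extended_domain \<Omega> \<epsilon>"
    have "0 < \<epsilon>" using \<epsilon> by simp
    have ul_C4: "C_up_to_boundary 4 ?S ul"
      and ul_eq: "AE x in lebesgue. x \<in> ?S \<longrightarrow> - laplacian ul x = s x"
      using ul by (auto simp: local_solution_def)
    note estimate = nonlocal_error_estimate[OF \<open>0 < \<epsilon>\<close> domain(1,2) kernel[OF \<epsilon>] normalization[OF \<epsilon>]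
        poincare[OF \<epsilon>] green[OF \<epsilon>] s ul_eq ul_C4 smooth_in_V[OF \<epsilon> ul_C4] vn un]
    show "L2_norm ?S (\<lambda>x. un x - ul x) \<le> Cpn * energy_norm (\<alpha> \<epsilon>) ?S (\<lambda>x. un x - ul x)"
      using estimate(1) by (rule poincare[OF \<epsilon>])
    have "0 \<le> D4_sup_norm ?S ul"
      using ul_C4 domain(1) \<open>0 < \<epsilon>\<close> by (intro D4_sup_norm_nonneg bounded_extended_domain)
    then have "C * \<epsilon>\<^sup>2 * D4_sup_norm ?S ul \<le> (C + 1) * \<epsilon>\<^sup>2 * D4_sup_norm ?S ul"
      by (intro mult_right_mono) auto
    with estimate(2) show "Cpn * energy_norm (\<alpha> \<epsilon>) ?S (\<lambda>x. un x - ul x)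
        \<le> (C + 1) * \<epsilon>\<^sup>2 * D4_sup_norm ?S ul"
      unfolding C_def by linarith
  qed
qed

end
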